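(* Let $G$ be a compact (Hausdorff, second countable) group with a compatible bi-invariant metric $d$. Suppose $(G,d)$ is $L$-locally random with coefficient $C_0$ and satisfies the dimension condition $\mathrm{DC}(C_1,d_0)$ for some $C_1\ge 1$, $d_0>0$. Then for every $f,g\in L^2(G)$ and every $\eta>0$ with $C_0\sqrt{\eta}\le 0.1$, $$\|f*g\|_2^2\le 2\,\|f_\eta*g_\eta\|_2^2+\eta^{1/(2L)}\,\|f\|_2^2\,\|g\|_2^2 .$$
   Context: $|\cdot|$ is the Haar probability measure on $G$, $L^p$ norms are taken with respect to it, and $(f*g)(x)=\int_G f(y)g(y^{-1}x)\,dy$. For $\eta>0$, $1_\eta$ is the open $d$-ball of radius $\eta$ about the identity, $P_\eta=\mathbf 1_{1_\eta}/|1_\eta|$, and $f_\eta=f*P_\eta$. For $C_0\ge1$, $L\ge 1$: $(G,d)$ is $L$-locally random with coefficient $C_0$ if $\|\pi(x)-\pi(y)\|_{\mathrm{op}}\le C_0(\dim\pi)^Ld(x,y)$ for every irreducible unitary representation $\pi$ of $G$ and all $x,y\in G$. $(G,d)$ satisfies $\mathrm{DC}(C_1,d_0)$ if $\frac1{C_1}\eta^{d_0}\le|1_\eta|\le C_1\eta^{d_0}$ for all $\eta\in(0,1)$. *)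

theory Defs
  imports
    "HOL-Probability.Probability"
    "Jordan_Normal_Form.Schur_Decomposition"
    "Jordan_Normal_Form.VS_Connect"
begin

text \<open>
  The group is a type of class \<open>topological_group_add\<close>. It is written additively, but it is
  not assumed to be commutative: \<open>x + y\<close> stands for \<open>xy\<close>, \<open>- x\<close> for the inverse of \<open>x\<close>, and \<open>0\<close>
  for the identity. The class \<open>metric_space\<close> says that the topology is the one induced by \<open>dist\<close>.
\<close>

definition bi_invariant_dist :: "'a::{metric_space, topological_group_add} itself \<Rightarrow> bool" where
  "bi_invariant_dist _ \<longleftrightarrow>
     (\<forall>a x y :: 'a. dist (a + x) (a + y) = dist x y \<and> dist (x + a) (y + a) = dist x y)"

definition haar_probability :: "'a::{metric_space, topological_group_add} measure \<Rightarrow> bool" where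
  "haar_probability \<mu> \<longleftrightarrow>
     prob_space \<mu> \<and> sets \<mu> = sets borel \<and> (\<forall>a. distr \<mu> borel (\<lambda>x. a + x) = \<mu>)"

definition L2_space :: "'a measure \<Rightarrow> ('a \<Rightarrow> complex) set" where
  "L2_space \<mu> = {f \<in> borel_measurable \<mu>. integrable \<mu> (\<lambda>x. (cmod (f x))\<^sup>2)}"

definition L2_norm :: "'a measure \<Rightarrow> ('a \<Rightarrow> complex) \<Rightarrow> real" where
  "L2_norm \<mu> f = sqrt (LINT x|\<mu>. (cmod (f x))\<^sup>2)"

definition group_convolution ::
    "'a::{metric_space, topological_group_add} measure \<Rightarrow> ('a \<Rightarrow> complex) \<Rightarrow> ('a \<Rightarrow> complex) \<Rightarrow> 'a \<Rightarrow> complex"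
  where "group_convolution \<mu> f g x = (LINT y|\<mu>. f y * g (- y + x))"

definition ball_kernel ::
    "'a::{metric_space, topological_group_add} measure \<Rightarrow> real \<Rightarrow> 'a \<Rightarrow> complex" where
  "ball_kernel \<mu> \<eta> x = indicator (ball 0 \<eta>) x / of_real (measure \<mu> (ball 0 \<eta>))"

definition smoothing ::
    "'a::{metric_space, topological_group_add} measure \<Rightarrow> real \<Rightarrow> ('a \<Rightarrow> complex) \<Rightarrow> 'a \<Rightarrow> complex" where
  "smoothing \<mu> \<eta> f = group_convolution \<mu> f (ball_kernel \<mu> \<eta>)"

text \<open>
  Irreducible unitary representations of a compact group are finite-dimensional, so up to the choice
  of an orthonormal basis they are the continuous irreducible homomorphisms into the unitary
  \<open>n \<times> n\<close> matrices. In finite dimension, strong continuity is continuity of the matrix entries.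
\<close>

definition unitary_rep :: "nat \<Rightarrow> ('a::{metric_space, topological_group_add} \<Rightarrow> complex mat) \<Rightarrow> bool"
  where
  "unitary_rep n \<pi> \<longleftrightarrow>
     (\<forall>x. \<pi> x \<in> carrier_mat n n \<and> mat_adjoint (\<pi> x) * \<pi> x = 1\<^sub>m n) \<and>
     \<pi> 0 = 1\<^sub>m n \<and> (\<forall>x y. \<pi> (x + y) = \<pi> x * \<pi> y) \<and>
     (\<forall>i<n. \<forall>j<n. continuous_on UNIV (\<lambda>x. \<pi> x $$ (i, j)))"

definition irreducible_rep :: "nat \<Rightarrow> ('a \<Rightarrow> complex mat) \<Rightarrow> bool" where
  "irreducible_rep n \<pi> \<longleftrightarrow> n > 0 \<and>
     (\<forall>W. VectorSpace.subspace class_ring W (module_vec TYPE(complex) n) \<and>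
          (\<forall>x. \<forall>w\<in>W. \<pi> x *\<^sub>v w \<in> W) \<longrightarrow>
          W = {0\<^sub>v n} \<or> W = carrier_vec n)"

definition vec_norm :: "complex vec \<Rightarrow> real" where
  "vec_norm v = sqrt (Re (v \<bullet>c v))"

definition mat_op_norm :: "complex mat \<Rightarrow> real" where
  "mat_op_norm A = (SUP v \<in> {v \<in> carrier_vec (dim_col A). vec_norm v \<le> 1}. vec_norm (A *\<^sub>v v))"

definition locally_random ::
    "'a::{metric_space, topological_group_add} itself \<Rightarrow> real \<Rightarrow> real \<Rightarrow> bool" where
  "locally_random _ L C\<^sub>0 \<longleftrightarrow>
     (\<forall>n (\<pi> :: 'a \<Rightarrow> complex mat). unitary_rep n \<pi> \<and> irreducible_rep n \<pi> \<longrightarrow>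
        (\<forall>x y. mat_op_norm (\<pi> x - \<pi> y) \<le> C\<^sub>0 * real n powr L * dist x y))"

definition dimension_condition ::
    "'a::{metric_space, topological_group_add} measure \<Rightarrow> real \<Rightarrow> real \<Rightarrow> bool" where
  "dimension_condition \<mu> C\<^sub>1 d\<^sub>0 \<longleftrightarrow>
     (\<forall>\<eta>\<in>{0<..<1}. 1 / C\<^sub>1 * \<eta> powr d\<^sub>0 \<le> measure \<mu> (ball 0 \<eta>) \<and>
                 measure \<mu> (ball 0 \<eta>) \<le> C\<^sub>1 * \<eta> powr d\<^sub>0)"

end

theory Submission
  imports Defs
begin

text \<open>
  Put \<open>h = g \<star> g~\<close> with \<open>g~(x) = cnj (g (- x))\<close>, so that \<open>\<parallel>f \<star> g\<parallel>\<^sup>2 = \<langle>f \<star> h, f\<rangle>\<close>. The map \<open>f \<mapsto> f \<star> h\<close> is positive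
  and commutes with left translations, and the Hilbert-Schmidt norm of \<open>f \<mapsto> f \<star> g\<close> is \<open>\<parallel>g\<parallel>\<close>. Hence on an
  irreducible translation-invariant space \<open>S\<close> of dimension \<open>n\<close> that consists of eigenfunctions with
  eigenvalue \<open>l\<close> one has \<open>n l \<le> \<parallel>g\<parallel>\<^sup>2\<close>. Take \<open>\<delta> = \<eta> powr (1 / (2 * L))\<close> and cut the spectrum at
  \<open>t = \<delta> \<parallel>g\<parallel>\<^sup>2\<close>. The part of \<open>f\<close> that belongs to eigenvalues up to \<open>t\<close> contributes at most
  \<open>t \<parallel>f\<parallel>\<^sup>2\<close>, which is the error term of the theorem. The rest lives on irreducible spaces of dimension
  \<open>n \<le> 1 / \<delta>\<close>, on which local randomness says that translation by an element at distance less than \<open>\<eta>\<close>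
  from the identity moves a vector \<open>u\<close> by at most \<open>C\<^sub>0 n powr L \<eta> \<parallel>u\<parallel> \<le> C\<^sub>0 sqrt \<eta> \<parallel>u\<parallel> \<le> \<parallel>u\<parallel> / 10\<close>. So
  averaging over the ball shrinks \<open>u\<close> at most by the factor \<open>9 / 10\<close>. The ball is invariant under
  conjugation, and therefore \<open>f\<^sub>\<eta> \<star> g\<^sub>\<eta>\<close> is \<open>f\<close>, averaged twice, convolved with \<open>g\<close>; two averages
  cost a factor \<open>(10 / 9)^4 < 2\<close> in the square of the norm.

  Instead of decomposing all of \<open>L\<^sup>2\<close>, the proof splits off one irreducible space at a time
  (\<open>peel_irreducible\<close>): if \<open>e\<close> is the kernel of the orthogonal projection onto \<open>S\<close>, then replacing \<open>g\<close>
  by \<open>g - e \<star> g\<close> removes exactly the contribution of \<open>S\<close> and lowers \<open>\<parallel>g\<parallel>\<^sup>2\<close> by at least \<open>t\<close>, so the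
  process ends (\<open>conv_norm_split\<close>). As long as the spectrum exceeds \<open>t\<close>, an eigenfunction is produced by
  power iteration (\<open>eigenfunction_exists\<close>): the normalised convolution powers of \<open>h\<close> converge
  uniformly. An invariant subspace of minimal dimension inside the eigenspace is irreducible, and the
  translations, written in an orthonormal basis of it, form a continuous irreducible unitary
  representation (\<open>unitary_matrix_coefficients\<close>, \<open>irreducible_matrix_coefficients\<close>), to which the hypothesis on
  \<open>G\<close> applies. Continuity comes from the fact that the convolution of two square-integrable functions is continuous
  (\<open>conv_continuous\<close>), which rests on the density of the continuous functions in \<open>L\<^sup>2\<close>.
\<close>

section \<open>Square-integrable functions\<close>

lemma measurable_cnj [measurable (raw)]:
  "f \<in> borel_measurable M \<Longrightarrow> (\<lambda>x. cnj (f x)) \<in> borel_measurable M"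
  using measurable_compose[OF _ borel_measurable_continuous_onI[of cnj]] by (simp add: continuous_intros)

definition L2_inner :: "'a measure \<Rightarrow> ('a \<Rightarrow> complex) \<Rightarrow> ('a \<Rightarrow> complex) \<Rightarrow> complex" where
  "L2_inner M u v = (LINT x|M. u x * cnj (v x))"

lemma L2_measurable [measurable_dest]: "u \<in> L2_space M \<Longrightarrow> u \<in> borel_measurable M"
  and L2_square_integrable: "u \<in> L2_space M \<Longrightarrow> integrable M (\<lambda>x. (cmod (u x))\<^sup>2)"
  by (simp_all add: L2_space_def)

lemma L2_norm_nonneg [simp]: "0 \<le> L2_norm M u"
  by (simp add: L2_norm_def)

lemma L2_norm_squared: "(L2_norm M u)\<^sup>2 = (LINT x|M. (cmod (u x))\<^sup>2)"
  by (simp add: L2_norm_def)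

lemma L2_mult_integrable:
  assumes u: "u \<in> L2_space M" and v: "v \<in> L2_space M"
  shows "integrable M (\<lambda>x. u x * v x)"
proof (rule Bochner_Integration.integrable_bound)
  show "integrable M (\<lambda>x. (cmod (u x))\<^sup>2 + (cmod (v x))\<^sup>2)"
    using u v by (intro Bochner_Integration.integrable_add L2_square_integrable)
  have "a * b \<le> a\<^sup>2 + b\<^sup>2" if "0 \<le> a" "0 \<le> b" for a b :: real
    using sum_squares_bound[of a b] that mult_nonneg_nonneg[OF that] by linarith
  then show "AE x in M. norm (u x * v x) \<le> norm ((cmod (u x))\<^sup>2 + (cmod (v x))\<^sup>2)"
    by (simp add: norm_mult)
  show "(\<lambda>x. u x * v x) \<in> borel_measurable M"
    using u v by measurable
qed

lemma L2_cnj: "u \<in> L2_space M \<Longrightarrow> (\<lambda>x. cnj (u x)) \<in> L2_space M"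
  by (auto simp: L2_space_def)

lemma L2_of_real_norm: "u \<in> L2_space M \<Longrightarrow> (\<lambda>x. of_real (cmod (u x))) \<in> L2_space M"
  by (auto simp: L2_space_def)

lemma L2_inner_integrable:
  "u \<in> L2_space M \<Longrightarrow> v \<in> L2_space M \<Longrightarrow> integrable M (\<lambda>x. u x * cnj (v x))"
  by (intro L2_mult_integrable L2_cnj)

lemma L2_norm_mult_integrable:
  assumes "u \<in> L2_space M" "v \<in> L2_space M"
  shows "integrable M (\<lambda>x. cmod (u x) * cmod (v x))"
  using integrable_norm[OF L2_mult_integrable[OF assms]] by (simp add: norm_mult)

lemma L2_scale: "u \<in> L2_space M \<Longrightarrow> (\<lambda>x. c * u x) \<in> L2_space M"
  by (auto simp: L2_space_def norm_mult power_mult_distrib)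

lemma L2_add:
  assumes u: "u \<in> L2_space M" and v: "v \<in> L2_space M"
  shows "(\<lambda>x. u x + v x) \<in> L2_space M"
proof -
  have "integrable M (\<lambda>x. (cmod (u x + v x))\<^sup>2)"
  proof (rule Bochner_Integration.integrable_bound)
    show "integrable M (\<lambda>x. 2 * (cmod (u x))\<^sup>2 + 2 * (cmod (v x))\<^sup>2)"
      using u v by (intro Bochner_Integration.integrable_add integrable_mult_right L2_square_integrable)
    show "(\<lambda>x. (cmod (u x + v x))\<^sup>2) \<in> borel_measurable M"
      using u v by measurable
    have "(cmod (a + b))\<^sup>2 \<le> 2 * (cmod a)\<^sup>2 + 2 * (cmod b)\<^sup>2" for a b
    proof -
      have "(cmod (a + b))\<^sup>2 \<le> (cmod a + cmod b)\<^sup>2"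
        by (intro power_mono norm_triangle_ineq) simp
      also have "\<dots> \<le> 2 * (cmod a)\<^sup>2 + 2 * (cmod b)\<^sup>2"
        using sum_squares_bound[of "cmod a" "cmod b"] by (simp add: power2_sum)
      finally show ?thesis .
    qed
    then show "AE x in M. norm ((cmod (u x + v x))\<^sup>2) \<le> norm (2 * (cmod (u x))\<^sup>2 + 2 * (cmod (v x))\<^sup>2)"
      by simp
  qed
  with u v show ?thesis
    by (auto simp: L2_space_def)
qed

lemma L2_diff: "u \<in> L2_space M \<Longrightarrow> v \<in> L2_space M \<Longrightarrow> (\<lambda>x. u x - v x) \<in> L2_space M"
  using L2_add[of u M "\<lambda>x. - 1 * v x"] L2_scale[of v M "- 1"] by simp

lemma L2_zero: "(\<lambda>x. 0) \<in> L2_space M"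
  by (simp add: L2_space_def)

lemma L2_sum: "(\<And>i. i \<in> I \<Longrightarrow> u i \<in> L2_space M) \<Longrightarrow> (\<lambda>x. \<Sum>i\<in>I. u i x) \<in> L2_space M"
  by (induction I rule: infinite_finite_induct) (simp_all add: L2_zero L2_add)

lemma L2_of_bounded:
  assumes "finite_measure M" "u \<in> borel_measurable M" "\<And>x. cmod (u x) \<le> B"
  shows "u \<in> L2_space M"
proof -
  interpret finite_measure M by fact
  have "integrable M (\<lambda>x. (cmod (u x))\<^sup>2)"
    using assms by (intro integrable_const_bound[of _ "B\<^sup>2"]) (auto intro!: power_mono)
  with assms show ?thesis
    by (simp add: L2_space_def)
qed

lemma L2_integrable:
  assumes "finite_measure M" "u \<in> L2_space M"
  shows "integrable M u"
  using L2_mult_integrable[OF assms(2) L2_of_bounded[OF assms(1), of "\<lambda>x. 1" 1]] by simp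

lemma L2_norm_mult_le:
  assumes u: "u \<in> L2_space M" and v: "v \<in> L2_space M"
  shows "(LINT x|M. cmod (u x) * cmod (v x)) \<le> L2_norm M u * L2_norm M v"
proof -
  have [measurable]: "u \<in> borel_measurable M" "v \<in> borel_measurable M"
    using u v by (simp_all add: L2_space_def)
  let ?I = "LINT x|M. cmod (u x) * cmod (v x)"
  have I0: "0 \<le> ?I"
    by simp
  have sq: "(\<integral>\<^sup>+x. (ennreal (cmod (w x)))\<^sup>2 \<partial>M) = ennreal ((L2_norm M w)\<^sup>2)" if "w \<in> L2_space M" for w
  proof -
    have "(\<integral>\<^sup>+x. (ennreal (cmod (w x)))\<^sup>2 \<partial>M) = (\<integral>\<^sup>+x. ennreal ((cmod (w x))\<^sup>2) \<partial>M)"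
      by (simp add: ennreal_power)
    then show ?thesis
      using L2_square_integrable[OF that] by (simp add: nn_integral_eq_integral L2_norm_squared)
  qed
  have "(\<integral>\<^sup>+x. ennreal (cmod (u x)) * ennreal (cmod (v x)) \<partial>M)
      = (\<integral>\<^sup>+x. ennreal (cmod (u x) * cmod (v x)) \<partial>M)"
    by (simp add: ennreal_mult)
  also have "\<dots> = ennreal ?I"
    using L2_norm_mult_integrable[OF u v] by (simp add: nn_integral_eq_integral)
  finally have "(ennreal ?I)\<^sup>2 \<le> ennreal ((L2_norm M u)\<^sup>2) * ennreal ((L2_norm M v)\<^sup>2)"
    using Cauchy_Schwarz_nn_integral[of "\<lambda>x. ennreal (cmod (u x))" M "\<lambda>x. ennreal (cmod (v x))"]
    by (simp add: sq u v)
  then have "?I\<^sup>2 \<le> (L2_norm M u * L2_norm M v)\<^sup>2"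
    using I0 by (simp add: ennreal_power ennreal_mult[symmetric] power_mult_distrib)
  then show ?thesis
    by (rule power2_le_imp_le) simp
qed

lemma L2_inner_le:
  assumes u: "u \<in> L2_space M" and v: "v \<in> L2_space M"
  shows "cmod (L2_inner M u v) \<le> L2_norm M u * L2_norm M v"
proof -
  have "cmod (L2_inner M u v) \<le> (LINT x|M. cmod (u x * cnj (v x)))"
    unfolding L2_inner_def by (rule integral_norm_bound)
  also have "\<dots> \<le> L2_norm M u * L2_norm M v"
    using L2_norm_mult_le[OF u v] by (simp add: norm_mult)
  finally show ?thesis .
qed

lemma L2_inner_self: "L2_inner M u u = of_real ((L2_norm M u)\<^sup>2)"
  by (simp add: L2_inner_def L2_norm_squared complex_norm_square[symmetric] integral_complex_of_real
      del: of_real_power)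

lemma L2_inner_commute: "L2_inner M v u = cnj (L2_inner M u v)"
  unfolding L2_inner_def
  by (subst Bochner_Integration.integral_cnj[symmetric]) (simp add: mult.commute)

lemma L2_inner_scale_left: "L2_inner M (\<lambda>x. c * u x) v = c * L2_inner M u v"
  by (simp add: L2_inner_def mult.assoc)

lemma L2_inner_scale_right: "L2_inner M u (\<lambda>x. c * v x) = cnj c * L2_inner M u v"
  by (simp add: L2_inner_def mult.left_commute)

lemma L2_inner_zero_left [simp]: "L2_inner M (\<lambda>x. 0) v = 0"
  by (simp add: L2_inner_def)

lemma
  assumes "u \<in> L2_space M" "u' \<in> L2_space M" "v \<in> L2_space M"
  shows L2_inner_add_left: "L2_inner M (\<lambda>x. u x + u' x) v = L2_inner M u v + L2_inner M u' v"
    and L2_inner_diff_left: "L2_inner M (\<lambda>x. u x - u' x) v = L2_inner M u v - L2_inner M u' v"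
    and L2_inner_add_right: "L2_inner M v (\<lambda>x. u x + u' x) = L2_inner M v u + L2_inner M v u'"
    and L2_inner_diff_right: "L2_inner M v (\<lambda>x. u x - u' x) = L2_inner M v u - L2_inner M v u'"
  using assms by (simp_all add: L2_inner_def ring_distribs L2_inner_integrable)

lemma L2_inner_sum_left:
  assumes "\<And>i. i \<in> I \<Longrightarrow> u i \<in> L2_space M" "v \<in> L2_space M"
  shows "L2_inner M (\<lambda>x. \<Sum>i\<in>I. u i x) v = (\<Sum>i\<in>I. L2_inner M (u i) v)"
  using assms(1) by (induction I rule: infinite_finite_induct)
    (simp_all add: L2_inner_add_left L2_sum assms(2))

lemma L2_norm_scale: "L2_norm M (\<lambda>x. c * u x) = cmod c * L2_norm M u"
  by (simp add: L2_norm_def norm_mult power_mult_distrib real_sqrt_mult)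

lemma L2_norm_zero [simp]: "L2_norm M (\<lambda>x. 0) = 0"
  by (simp add: L2_norm_def)

lemma L2_norm_add_squared:
  assumes "u \<in> L2_space M" "v \<in> L2_space M"
  shows "(L2_norm M (\<lambda>x. u x + v x))\<^sup>2 = (L2_norm M u)\<^sup>2 + 2 * Re (L2_inner M u v) + (L2_norm M v)\<^sup>2"
proof -
  have "complex_of_real ((L2_norm M (\<lambda>x. u x + v x))\<^sup>2)
      = of_real ((L2_norm M u)\<^sup>2) + (L2_inner M u v + cnj (L2_inner M u v)) + of_real ((L2_norm M v)\<^sup>2)"
    unfolding L2_inner_self[symmetric]
    using assms by (simp add: L2_inner_add_left L2_inner_add_right L2_add L2_inner_commute[of M v u])
  also have "\<dots> = of_real ((L2_norm M u)\<^sup>2 + 2 * Re (L2_inner M u v) + (L2_norm M v)\<^sup>2)"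
    by (simp add: complex_add_cnj)
  finally show ?thesis
    by (simp only: of_real_eq_iff)
qed

lemma L2_norm_pythagoras:
  assumes "u \<in> L2_space M" "v \<in> L2_space M" "L2_inner M u v = 0"
  shows "(L2_norm M (\<lambda>x. u x + v x))\<^sup>2 = (L2_norm M u)\<^sup>2 + (L2_norm M v)\<^sup>2"
  using assms by (simp add: L2_norm_add_squared)

lemma L2_norm_triangle:
  assumes "u \<in> L2_space M" "v \<in> L2_space M"
  shows "L2_norm M (\<lambda>x. u x + v x) \<le> L2_norm M u + L2_norm M v"
proof (rule power2_le_imp_le)
  show "(L2_norm M (\<lambda>x. u x + v x))\<^sup>2 \<le> (L2_norm M u + L2_norm M v)\<^sup>2"
    using L2_inner_le[OF assms] complex_Re_le_cmod[of "L2_inner M u v"]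
    by (simp add: L2_norm_add_squared assms power2_sum)
qed simp

definition orthonormal :: "'a measure \<Rightarrow> nat \<Rightarrow> (nat \<Rightarrow> 'a \<Rightarrow> complex) \<Rightarrow> bool" where
  "orthonormal M n w \<longleftrightarrow> (\<forall>i<n. w i \<in> L2_space M) \<and>
     (\<forall>i<n. \<forall>j<n. L2_inner M (w i) (w j) = (if i = j then 1 else 0))"

definition projection :: "'a measure \<Rightarrow> nat \<Rightarrow> (nat \<Rightarrow> 'a \<Rightarrow> complex) \<Rightarrow> ('a \<Rightarrow> complex) \<Rightarrow> 'a \<Rightarrow> complex"
  where "projection M n w u x = (\<Sum>i<n. L2_inner M u (w i) * w i x)"

lemma orthonormal_L2: "orthonormal M n w \<Longrightarrow> i < n \<Longrightarrow> w i \<in> L2_space M"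
  and orthonormal_inner:
    "orthonormal M n w \<Longrightarrow> i < n \<Longrightarrow> j < n \<Longrightarrow> L2_inner M (w i) (w j) = (if i = j then 1 else 0)"
  by (auto simp: orthonormal_def)

lemma orthonormal_comb_L2:
  "orthonormal M n w \<Longrightarrow> (\<lambda>x. \<Sum>i<n. c i * w i x) \<in> L2_space M"
  by (intro L2_sum L2_scale) (auto simp: orthonormal_L2)

lemma projection_L2: "orthonormal M n w \<Longrightarrow> projection M n w u \<in> L2_space M"
  unfolding projection_def[abs_def] by (rule orthonormal_comb_L2)

lemma orthonormal_comb_inner_left:
  assumes "orthonormal M n w" "v \<in> L2_space M"
  shows "L2_inner M (\<lambda>x. \<Sum>i<n. c i * w i x) v = (\<Sum>i<n. c i * L2_inner M (w i) v)"
  using assms by (subst L2_inner_sum_left) (auto simp: L2_scale orthonormal_L2 L2_inner_scale_left)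

lemma orthonormal_comb_inner:
  assumes w: "orthonormal M n w" and j: "j < n"
  shows "L2_inner M (\<lambda>x. \<Sum>i<n. c i * w i x) (w j) = c j"
proof -
  have "L2_inner M (\<lambda>x. \<Sum>i<n. c i * w i x) (w j) = (\<Sum>i<n. c i * (if i = j then 1 else 0))"
    using w j by (subst orthonormal_comb_inner_left) (auto simp: orthonormal_L2 orthonormal_inner)
  also have "\<dots> = (\<Sum>i<n. if i = j then c i else 0)"
    by (intro sum.cong) auto
  finally show ?thesis
    using j by simp
qed

lemma projection_inner:
  "orthonormal M n w \<Longrightarrow> j < n \<Longrightarrow> L2_inner M (projection M n w u) (w j) = L2_inner M u (w j)"
  unfolding projection_def[abs_def] by (rule orthonormal_comb_inner)

lemma orthonormal_comb_inner_comb: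
  assumes w: "orthonormal M n w"
  shows "L2_inner M (\<lambda>x. \<Sum>i<n. c i * w i x) (\<lambda>x. \<Sum>i<n. d i * w i x) = (\<Sum>i<n. c i * cnj (d i))"
proof -
  have "L2_inner M (w i) (\<lambda>x. \<Sum>i<n. d i * w i x) = cnj (d i)" if "i < n" for i
    using orthonormal_comb_inner[OF w that, of d] by (subst L2_inner_commute) simp
  then show ?thesis
    by (subst orthonormal_comb_inner_left[OF w orthonormal_comb_L2[OF w]]) simp
qed

lemma orthonormal_comb_norm:
  assumes w: "orthonormal M n w"
  shows "(L2_norm M (\<lambda>x. \<Sum>i<n. c i * w i x))\<^sup>2 = (\<Sum>i<n. (cmod (c i))\<^sup>2)"
proof -
  have "complex_of_real ((L2_norm M (\<lambda>x. \<Sum>i<n. c i * w i x))\<^sup>2) = of_real (\<Sum>i<n. (cmod (c i))\<^sup>2)"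
    unfolding L2_inner_self[symmetric] orthonormal_comb_inner_comb[OF w]
    by (simp add: complex_norm_square[symmetric] del: of_real_power)
  then show ?thesis
    by (simp only: of_real_eq_iff)
qed

lemma projection_residue_orthogonal:
  assumes w: "orthonormal M n w" and u: "u \<in> L2_space M"
  shows "j < n \<Longrightarrow> L2_inner M (\<lambda>x. u x - projection M n w u x) (w j) = 0"
    and "L2_inner M (projection M n w u') (\<lambda>x. u x - projection M n w u x) = 0"
proof -
  show 1: "L2_inner M (\<lambda>x. u x - projection M n w u x) (w j) = 0" if "j < n" for j
    using that w u by (subst L2_inner_diff_left) (auto simp: projection_inner projection_L2 orthonormal_L2)
  have "L2_inner M (w i) (\<lambda>x. u x - projection M n w u x) = 0" if "i < n" for i
    using 1[OF that] by (subst L2_inner_commute) simp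
  then show "L2_inner M (projection M n w u') (\<lambda>x. u x - projection M n w u x) = 0"
    unfolding projection_def[of M n w u', abs_def]
    by (subst orthonormal_comb_inner_left[OF w L2_diff[OF u projection_L2[OF w]]]) simp
qed

lemma projection_pythagoras:
  assumes w: "orthonormal M n w" and u: "u \<in> L2_space M"
  shows "(L2_norm M u)\<^sup>2 = (L2_norm M (projection M n w u))\<^sup>2 + (L2_norm M (\<lambda>x. u x - projection M n w u x))\<^sup>2"
  using L2_norm_pythagoras[OF projection_L2[OF w] L2_diff[OF u projection_L2[OF w]]
      projection_residue_orthogonal(2)[OF w u], of u] by simp

lemma bessel:
  assumes w: "orthonormal M n w" and u: "u \<in> L2_space M"
  shows "(\<Sum>i<n. (cmod (L2_inner M u (w i)))\<^sup>2) \<le> (L2_norm M u)\<^sup>2"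
  unfolding projection_pythagoras[OF w u]
  by (simp add: projection_def[abs_def] orthonormal_comb_norm[OF w])

section \<open>Density of the continuous functions\<close>

definition continuous_L2_closure :: "'a::metric_space measure \<Rightarrow> ('a \<Rightarrow> complex) set" where
  "continuous_L2_closure M = {u \<in> L2_space M. \<forall>\<epsilon>>0. \<exists>\<phi>. continuous_on UNIV \<phi> \<and>
     \<phi> \<in> L2_space M \<and> L2_norm M (\<lambda>x. u x - \<phi> x) < \<epsilon>}"

lemma continuous_L2_closureI:
  "continuous_on UNIV \<phi> \<Longrightarrow> \<phi> \<in> L2_space M \<Longrightarrow> \<phi> \<in> continuous_L2_closure M"
  by (auto simp: continuous_L2_closure_def intro!: exI[of _ \<phi>])

lemma continuous_L2_closure_L2: "u \<in> continuous_L2_closure M \<Longrightarrow> u \<in> L2_space M"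
  by (simp add: continuous_L2_closure_def)

lemma continuous_L2_closureE:
  assumes "u \<in> continuous_L2_closure M" "\<epsilon> > 0"
  obtains \<phi> where "continuous_on UNIV \<phi>" "\<phi> \<in> L2_space M" "L2_norm M (\<lambda>x. u x - \<phi> x) < \<epsilon>"
proof -
  have "\<exists>\<phi>. continuous_on UNIV \<phi> \<and> \<phi> \<in> L2_space M \<and> L2_norm M (\<lambda>x. u x - \<phi> x) < \<epsilon>"
    using assms by (simp add: continuous_L2_closure_def)
  with that show ?thesis by (elim exE conjE)
qed

lemma continuous_L2_closure_add:
  assumes u: "u \<in> continuous_L2_closure M" and v: "v \<in> continuous_L2_closure M"
  shows "(\<lambda>x. u x + v x) \<in> continuous_L2_closure M"
proof -
  have "\<exists>\<phi>. continuous_on UNIV \<phi> \<and> \<phi> \<in> L2_space M \<and> L2_norm M (\<lambda>x. u x + v x - \<phi> x) < \<epsilon>"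
    if eps: "\<epsilon> > 0" for \<epsilon>
  proof -
    obtain \<phi> where \<phi>: "continuous_on UNIV \<phi>" "\<phi> \<in> L2_space M"
      "L2_norm M (\<lambda>x. u x - \<phi> x) < \<epsilon> / 2"
      by (rule continuous_L2_closureE[OF u half_gt_zero[OF eps]])
    obtain \<psi> where \<psi>: "continuous_on UNIV \<psi>" "\<psi> \<in> L2_space M"
      "L2_norm M (\<lambda>x. v x - \<psi> x) < \<epsilon> / 2"
      by (rule continuous_L2_closureE[OF v half_gt_zero[OF eps]])
    have "L2_norm M (\<lambda>x. u x + v x - (\<phi> x + \<psi> x)) \<le> L2_norm M (\<lambda>x. u x - \<phi> x) + L2_norm M (\<lambda>x. v x - \<psi> x)"
      using L2_norm_triangle[OF L2_diff[OF continuous_L2_closure_L2[OF u] \<phi>(2)]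
          L2_diff[OF continuous_L2_closure_L2[OF v] \<psi>(2)]]
      by (simp add: algebra_simps)
    then show ?thesis
      using \<phi> \<psi> by (intro exI[of _ "\<lambda>x. \<phi> x + \<psi> x"]) (auto intro!: continuous_intros L2_add)
  qed
  then show ?thesis
    using u v by (auto simp: continuous_L2_closure_def L2_add)
qed

lemma continuous_L2_closure_scale:
  assumes u: "u \<in> continuous_L2_closure M"
  shows "(\<lambda>x. c * u x) \<in> continuous_L2_closure M"
proof -
  have "\<exists>\<phi>. continuous_on UNIV \<phi> \<and> \<phi> \<in> L2_space M \<and> L2_norm M (\<lambda>x. c * u x - \<phi> x) < \<epsilon>"
    if eps: "\<epsilon> > 0" for \<epsilon>
  proof -
    have "\<epsilon> / (cmod c + 1) > 0"
      using eps by (simp add: add_nonneg_pos)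
    then obtain \<phi> where \<phi>: "continuous_on UNIV \<phi>" "\<phi> \<in> L2_space M"
      "L2_norm M (\<lambda>x. u x - \<phi> x) < \<epsilon> / (cmod c + 1)"
      by (rule continuous_L2_closureE[OF u])
    have "L2_norm M (\<lambda>x. c * u x - c * \<phi> x) = cmod c * L2_norm M (\<lambda>x. u x - \<phi> x)"
      by (simp add: right_diff_distrib[symmetric] L2_norm_scale)
    also have "\<dots> \<le> cmod c * (\<epsilon> / (cmod c + 1))"
      using \<phi>(3) by (intro mult_left_mono) auto
    also have "\<dots> < \<epsilon>"
    proof -
      have pos: "cmod c + 1 > 0"
        by (simp add: add_nonneg_pos)
      then have "cmod c * (\<epsilon> / (cmod c + 1)) = \<epsilon> - \<epsilon> / (cmod c + 1)"
        by (simp add: field_simps)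
      with pos eps show ?thesis by simp
    qed
    finally show ?thesis
      using \<phi> by (intro exI[of _ "\<lambda>x. c * \<phi> x"]) (auto intro!: continuous_intros L2_scale)
  qed
  then show ?thesis
    using u by (auto simp: continuous_L2_closure_def L2_scale)
qed

lemma continuous_L2_closure_sum:
  "(\<And>i. i \<in> I \<Longrightarrow> u i \<in> continuous_L2_closure M) \<Longrightarrow> (\<lambda>x. \<Sum>i\<in>I. u i x) \<in> continuous_L2_closure M"
  by (induction I rule: infinite_finite_induct)
    (simp_all add: continuous_L2_closure_add continuous_L2_closureI L2_zero)

text \<open>
  This one closure property carries the density proof from Lipschitz functions to indicators of open sets,
  from finite to countable disjoint unions, and from simple functions to arbitrary ones.
\<close>

lemma continuous_L2_closure_dominated_limit:
  assumes s: "\<And>i::nat. s i \<in> continuous_L2_closure M" and u: "u \<in> borel_measurable M"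
    and lim: "\<And>x. x \<in> space M \<Longrightarrow> (\<lambda>i. s i x) \<longlonglongrightarrow> u x"
    and G: "G \<in> L2_space M"
    and bound: "\<And>i x. x \<in> space M \<Longrightarrow> cmod (s i x) \<le> cmod (G x)"
      "\<And>x. x \<in> space M \<Longrightarrow> cmod (u x) \<le> cmod (G x)"
  shows "u \<in> continuous_L2_closure M"
proof -
  have u2: "u \<in> L2_space M"
  proof -
    have "integrable M (\<lambda>x. (cmod (u x))\<^sup>2)"
      using u bound(2) by (intro Bochner_Integration.integrable_bound[OF L2_square_integrable[OF G]])
        (auto intro!: AE_I2 power_mono)
    with u show ?thesis by (simp add: L2_space_def)
  qed
  note s2 = continuous_L2_closure_L2[OF s]
  have "(\<lambda>i. LINT x|M. (cmod (u x - s i x))\<^sup>2) \<longlonglongrightarrow> (LINT x|M. 0)"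
  proof (rule integral_dominated_convergence)
    show "(\<lambda>x. (cmod (u x - s i x))\<^sup>2) \<in> borel_measurable M" for i
      using u L2_measurable[OF s2] by measurable
    show "integrable M (\<lambda>x. 4 * (cmod (G x))\<^sup>2)"
      using L2_square_integrable[OF G] by simp
    have "(cmod (u x - s i x))\<^sup>2 \<le> 4 * (cmod (G x))\<^sup>2" if "x \<in> space M" for i x
    proof -
      have "cmod (u x - s i x) \<le> 2 * cmod (G x)"
        using norm_triangle_ineq4[of "u x" "s i x"] bound(1)[OF that, of i] bound(2)[OF that] by linarith
      then have "(cmod (u x - s i x))\<^sup>2 \<le> (2 * cmod (G x))\<^sup>2"
        by (intro power_mono) auto
      then show ?thesis by (simp add: power_mult_distrib)
    qed
    then show "AE x in M. norm ((cmod (u x - s i x))\<^sup>2) \<le> 4 * (cmod (G x))\<^sup>2" for i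
      by (auto intro!: AE_I2)
    have "(\<lambda>i. (cmod (u x - s i x))\<^sup>2) \<longlonglongrightarrow> 0" if "x \<in> space M" for x
    proof -
      have "(\<lambda>i. (cmod (u x - s i x))\<^sup>2) \<longlonglongrightarrow> (cmod (u x - u x))\<^sup>2"
        by (intro tendsto_intros lim[OF that])
      then show ?thesis by simp
    qed
    then show "AE x in M. (\<lambda>i. (cmod (u x - s i x))\<^sup>2) \<longlonglongrightarrow> 0"
      by (auto intro!: AE_I2)
  qed simp
  then have "(\<lambda>i. sqrt (LINT x|M. (cmod (u x - s i x))\<^sup>2)) \<longlonglongrightarrow> sqrt 0"
    by (intro tendsto_real_sqrt) simp
  then have lim0: "(\<lambda>i. L2_norm M (\<lambda>x. u x - s i x)) \<longlonglongrightarrow> 0"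
    by (simp add: L2_norm_def)
  have "\<exists>\<phi>. continuous_on UNIV \<phi> \<and> \<phi> \<in> L2_space M \<and> L2_norm M (\<lambda>x. u x - \<phi> x) < \<epsilon>"
    if eps: "\<epsilon> > 0" for \<epsilon>
  proof -
    have "eventually (\<lambda>i. L2_norm M (\<lambda>x. u x - s i x) < \<epsilon> / 2) sequentially"
      using lim0 that by (intro order_tendstoD) auto
    then obtain i where i: "L2_norm M (\<lambda>x. u x - s i x) < \<epsilon> / 2"
      by (auto simp: eventually_sequentially)
    obtain \<phi> where \<phi>: "continuous_on UNIV \<phi>" "\<phi> \<in> L2_space M"
      "L2_norm M (\<lambda>x. s i x - \<phi> x) < \<epsilon> / 2"
      by (rule continuous_L2_closureE[OF s[of i] half_gt_zero[OF eps]])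
    have "L2_norm M (\<lambda>x. u x - \<phi> x) < \<epsilon>"
      using L2_norm_triangle[OF L2_diff[OF u2 s2[of i]] L2_diff[OF s2[of i] \<phi>(2)]] i \<phi>(3) by simp
    with \<phi>(1,2) show ?thesis by (intro exI[of _ \<phi>] conjI)
  qed
  with u2 show ?thesis
    by (auto simp: continuous_L2_closure_def)
qed

lemma cmod_indicator_le: "cmod (indicator A x) \<le> 1"
  by (simp add: indicator_def)

text \<open>
  The sets with an approximable indicator form a Dynkin system. It contains the open sets, since
  \<open>min 1 (n * infdist x (- U))\<close> increases to the indicator of \<open>U\<close>, and these are closed under
  intersection and generate the Borel sets.
\<close>

lemma indicator_continuous_L2_closure:
  fixes M :: "'a::metric_space measure"
  assumes fin: "finite_measure M" and M: "sets M = sets borel" and A: "A \<in> sets borel"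
  shows "(indicator A :: 'a \<Rightarrow> complex) \<in> continuous_L2_closure M"
proof -
  interpret finite_measure M by fact
  note [measurable_cong] = M
  have bdd: "u \<in> L2_space M" if "u \<in> borel_measurable M" "\<And>x. cmod (u x) \<le> 1" for u
    by (rule L2_of_bounded[OF fin that])
  have one: "(\<lambda>x. 1) \<in> L2_space M"
    by (rule bdd) auto
  have A': "A \<in> sigma_sets UNIV {S. open S}"
    using A by (simp add: sets_borel)
  have "Int_stable {S::'a set. open S}" "{S. open S} \<subseteq> Pow (UNIV :: 'a set)"
    by (auto simp: Int_stable_def)
  then show ?thesis
    using A'
  proof (induction rule: sigma_sets_induct_disjoint)
    case (basic U)
    then have U: "open U" by simp
    show ?case
    proof (cases "U = UNIV")
      case True
      then show ?thesis
        using continuous_L2_closureI[OF _ one] by (simp add: indicator_def)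
    next
      case False
      define s where "s n x = complex_of_real (min 1 (real n * infdist x (- U)))" for n x
      have s_cont: "continuous_on UNIV (s n)" for n
        unfolding s_def by (intro continuous_intros)
      have s_le: "cmod (s n x) \<le> 1" for n x
        unfolding s_def norm_of_real by (simp add: infdist_nonneg)
      have "s n \<in> borel_measurable M" for n
        using borel_measurable_continuous_onI[OF s_cont[of n]] by simp
      then have "s n \<in> continuous_L2_closure M" for n
        using s_le by (intro continuous_L2_closureI s_cont bdd)
      moreover have "(\<lambda>n. s n x) \<longlonglongrightarrow> indicator U x" for x
      proof (cases "x \<in> U")
        case True
        then have pos: "infdist x (- U) > 0"
          using U False by (intro infdist_pos_not_in_closed) auto
        obtain N :: nat where N: "1 / infdist x (- U) < real N"
          using reals_Archimedean2 by blast
        have "s n x = 1" if "n \<ge> N" for n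
        proof -
          have "1 \<le> real N * infdist x (- U)"
            using N pos by (simp add: field_simps)
          also have "\<dots> \<le> real n * infdist x (- U)"
            using that pos by (intro mult_right_mono) auto
          finally show ?thesis by (simp add: s_def)
        qed
        then have "eventually (\<lambda>n. s n x = 1) sequentially"
          by (auto simp: eventually_sequentially)
        with True show ?thesis
          by (simp add: tendsto_eventually)
      next
        case False
        then show ?thesis by (simp add: s_def)
      qed
      moreover have "(indicator U :: 'a \<Rightarrow> complex) \<in> borel_measurable M"
        using U M by (intro borel_measurable_indicator) (simp add: borel_open)
      ultimately show ?thesis
        using s_le by - (rule continuous_L2_closure_dominated_limit[OF _ _ _ one, of s],
          simp_all add: cmod_indicator_le)
    qed
  next
    case empty
    show ?case
      using continuous_L2_closureI[OF _ L2_zero] by (simp add: indicator_def)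
  next
    case (compl A)
    have "(\<lambda>x. 1 + - 1 * indicator A x) \<in> continuous_L2_closure M"
      by (intro continuous_L2_closure_add continuous_L2_closureI one
          continuous_L2_closure_scale[OF compl.IH]) simp
    moreover have "(\<lambda>x. 1 + - 1 * indicator A x) = (indicator (UNIV - A) :: 'a \<Rightarrow> complex)"
      by (auto simp: indicator_def)
    ultimately show ?case by simp
  next
    case (union A)
    have [measurable]: "A i \<in> sets borel" for i
      using union(2) by (auto simp: sets_borel)
    have "(indicator (\<Union>i<k. A i) :: 'a \<Rightarrow> complex) = (\<lambda>x. \<Sum>i<k. indicator (A i) x)" for k
      using union(1) by (intro ext indicator_UN_disjoint) (auto simp: disjoint_family_on_def)
    then have "(indicator (\<Union>i<k. A i) :: 'a \<Rightarrow> complex) \<in> continuous_L2_closure M" for k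
      using continuous_L2_closure_sum[of "{..<k}" "\<lambda>i. indicator (A i)"] union(3) by simp
    then show ?case
      by (rule continuous_L2_closure_dominated_limit[OF _ _ _ one, of "\<lambda>k. indicator (\<Union>i<k. A i)"])
        (simp_all add: cmod_indicator_le LIMSEQ_indicator_UN)
  qed
qed

theorem continuous_dense_L2:
  fixes M :: "'a::metric_space measure"
  assumes fin: "finite_measure M" and M: "sets M = sets borel" and u: "u \<in> L2_space M"
  shows "u \<in> continuous_L2_closure M"
proof -
  note [measurable_cong] = M
  have um: "u \<in> borel_measurable M"
    using u by measurable
  from borel_measurable_implies_sequence_metric[OF um, of 0] obtain s
    where s: "\<And>i. simple_function M (s i)"
      and lim: "\<forall>x\<in>space M. (\<lambda>i. s i x) \<longlonglongrightarrow> u x"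
      and bound: "\<forall>i. \<forall>x\<in>space M. dist (s i x) 0 \<le> 2 * dist (u x) 0"
    by blast
  have sp: "space M = UNIV"
    using sets_eq_imp_space_eq[OF M] by simp
  have "s i \<in> continuous_L2_closure M" for i
  proof -
    have "(\<lambda>x. \<Sum>c\<in>range (s i). c * indicator (s i -` {c}) x) \<in> continuous_L2_closure M"
      using simple_functionD(2)[OF s, of i] M sp
      by (intro continuous_L2_closure_sum continuous_L2_closure_scale
          indicator_continuous_L2_closure[OF fin M]) auto
    moreover have "(\<Sum>c\<in>range (s i). c * indicator (s i -` {c}) x) = s i x" for x
    proof -
      have "(\<Sum>c\<in>range (s i). c * indicator (s i -` {c}) x) = (\<Sum>c\<in>range (s i). if c = s i x then c else 0)"
        by (intro sum.cong) (auto simp: indicator_def)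
      then show ?thesis
        using simple_functionD(1)[OF s, of i] sp by simp
    qed
    ultimately show ?thesis by simp
  qed
  then show ?thesis
    using lim bound
    by - (rule continuous_L2_closure_dominated_limit[OF _ um _ L2_scale[OF u, of 2], of s],
      auto simp: norm_mult intro: order_trans[of _ "2 * cmod (u x)" for x])
qed

section \<open>Invariance of the Haar measure\<close>

locale compact_metric_group =
  fixes \<mu> :: "'a::{metric_space, second_countable_topology, topological_group_add} measure"
  assumes compact_group: "compact (UNIV :: 'a set)"
    and bi_invariant: "bi_invariant_dist TYPE('a)"
    and haar: "haar_probability \<mu>"
begin

lemma dist_left [simp]: "dist (a + x) (a + y) = dist x (y :: 'a)"
  and dist_right [simp]: "dist (x + a) (y + a) = dist x (y :: 'a)"
  using bi_invariant by (auto simp: bi_invariant_dist_def)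

lemma sets_haar [measurable_cong, simp]: "sets \<mu> = sets borel"
  using haar by (simp add: haar_probability_def)

lemma space_haar [simp]: "space \<mu> = UNIV"
  using sets_eq_imp_space_eq[OF sets_haar] by simp

sublocale prob_space \<mu>
  using haar by (simp add: haar_probability_def)

sublocale pair_sigma_finite \<mu> \<mu> ..

lemma measurable_uminus [measurable (raw)]:
  assumes "f \<in> borel_measurable M"
  shows "(\<lambda>x. - f x :: 'a) \<in> borel_measurable M"
proof -
  have "uminus \<in> borel_measurable (borel :: 'a measure)"
    by (intro borel_measurable_continuous_onI continuous_intros)
  with assms show ?thesis
    using measurable_compose by blast
qed

lemma measurable_diff [measurable (raw)]:
  assumes [measurable]: "f \<in> borel_measurable M" "g \<in> borel_measurable M"
  shows "(\<lambda>x. f x - g x :: 'a) \<in> borel_measurable M"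
  unfolding diff_conv_add_uminus by measurable

lemma distr_left: "distr \<mu> borel (\<lambda>x. a + x) = \<mu>"
  using haar by (simp add: haar_probability_def)

text \<open>
  Integrate \<open>indicator A (- x + y)\<close> over both variables: integrating over \<open>y\<close> first gives the measure of
  \<open>A\<close> by left invariance, and integrating over \<open>x\<close> first gives the measure of the set of inverses of \<open>A\<close>.
\<close>

lemma distr_uminus: "distr \<mu> borel uminus = \<mu>"
proof (rule measure_eqI)
  fix A :: "'a set" assume "A \<in> sets (distr \<mu> borel uminus)"
  then have [measurable]: "A \<in> sets borel"
    by simp
  have inv: "(\<integral>\<^sup>+x. F (a + x) \<partial>\<mu>) = (\<integral>\<^sup>+x. F x \<partial>\<mu>)" if [measurable]: "F \<in> borel_measurable borel"
    for F :: "'a \<Rightarrow> ennreal" and a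
    by (subst (2) distr_left[of a, symmetric], subst nn_integral_distr) simp_all
  have "(\<integral>\<^sup>+x. \<integral>\<^sup>+y. indicator A (- x + y) \<partial>\<mu> \<partial>\<mu>) = (\<integral>\<^sup>+x. \<integral>\<^sup>+y. (indicator A y :: ennreal) \<partial>\<mu> \<partial>\<mu>)"
    by (intro nn_integral_cong inv) simp
  then have 1: "(\<integral>\<^sup>+x. \<integral>\<^sup>+y. indicator A (- x + y) \<partial>\<mu> \<partial>\<mu>) = emeasure \<mu> A"
    by (simp add: emeasure_space_1[simplified])
  have "(\<integral>\<^sup>+x. indicator A (- x + y) \<partial>\<mu>) = (\<integral>\<^sup>+x. indicator A (- x) \<partial>\<mu>)" for y
    using inv[of "\<lambda>x. indicator A (- x)" "- y"] by (simp add: minus_add)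
  moreover have "(\<integral>\<^sup>+x. \<integral>\<^sup>+y. indicator A (- x + y) \<partial>\<mu> \<partial>\<mu>) = (\<integral>\<^sup>+y. \<integral>\<^sup>+x. indicator A (- x + y) \<partial>\<mu> \<partial>\<mu>)"
    by (rule Fubini'[symmetric]) measurable
  ultimately have "emeasure \<mu> A = (\<integral>\<^sup>+y. \<integral>\<^sup>+x. indicator A (- x) \<partial>\<mu> \<partial>\<mu>)"
    using 1 by simp
  also have "\<dots> = (\<integral>\<^sup>+x. indicator A (- x) \<partial>\<mu>)"
    by (simp add: emeasure_space_1[simplified])
  also have "\<dots> = (\<integral>\<^sup>+x. indicator A x \<partial>distr \<mu> borel uminus)"
    by (subst nn_integral_distr) simp_all
  finally show "emeasure (distr \<mu> borel uminus) A = emeasure \<mu> A"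
    by simp
qed simp

lemma distr_right: "distr \<mu> borel (\<lambda>x. x + a) = \<mu>"
proof -
  have "distr \<mu> borel (\<lambda>x. x + a) = distr (distr (distr \<mu> borel uminus) borel (\<lambda>x. - a + x)) borel uminus"
    by (simp add: distr_distr o_def minus_add)
  then show ?thesis
    by (simp add: distr_uminus distr_left)
qed

lemma
  fixes F :: "'a \<Rightarrow> 'b::{banach, second_countable_topology}"
  assumes [measurable]: "F \<in> borel_measurable borel"
  shows integral_left: "(LINT x|\<mu>. F (a + x)) = (LINT x|\<mu>. F x)"
    and integral_right: "(LINT x|\<mu>. F (x + a)) = (LINT x|\<mu>. F x)"
    and integral_uminus: "(LINT x|\<mu>. F (- x)) = (LINT x|\<mu>. F x)"
    and integrable_left: "integrable \<mu> (\<lambda>x. F (a + x)) = integrable \<mu> F"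
    and integrable_uminus: "integrable \<mu> (\<lambda>x. F (- x)) = integrable \<mu> F"
proof -
  show "(LINT x|\<mu>. F (a + x)) = (LINT x|\<mu>. F x)"
    by (subst (2) distr_left[of a, symmetric], subst integral_distr) simp_all
  show "(LINT x|\<mu>. F (x + a)) = (LINT x|\<mu>. F x)"
    by (subst (2) distr_right[of a, symmetric], subst integral_distr) simp_all
  show "(LINT x|\<mu>. F (- x)) = (LINT x|\<mu>. F x)"
    by (subst (2) distr_uminus[symmetric], subst integral_distr) simp_all
  show "integrable \<mu> (\<lambda>x. F (a + x)) = integrable \<mu> F"
    by (subst (2) distr_left[of a, symmetric], subst integrable_distr_eq) simp_all
  show "integrable \<mu> (\<lambda>x. F (- x)) = integrable \<mu> F"
    by (subst (2) distr_uminus[symmetric], subst integrable_distr_eq) simp_all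
qed

section \<open>Convolution\<close>

abbreviation L2 :: "('a \<Rightarrow> complex) set" where "L2 \<equiv> L2_space \<mu>"

abbreviation ip :: "('a \<Rightarrow> complex) \<Rightarrow> ('a \<Rightarrow> complex) \<Rightarrow> complex" where "ip \<equiv> L2_inner \<mu>"

abbreviation nrm :: "('a \<Rightarrow> complex) \<Rightarrow> real" where "nrm \<equiv> L2_norm \<mu>"

abbreviation conv :: "('a \<Rightarrow> complex) \<Rightarrow> ('a \<Rightarrow> complex) \<Rightarrow> 'a \<Rightarrow> complex" (infixl "\<star>" 70)
  where "u \<star> v \<equiv> group_convolution \<mu> u v"

definition translate :: "'a \<Rightarrow> ('a \<Rightarrow> complex) \<Rightarrow> 'a \<Rightarrow> complex" where
  "translate a u = (\<lambda>x. u (- a + x))"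

definition invol :: "('a \<Rightarrow> complex) \<Rightarrow> 'a \<Rightarrow> complex" where
  "invol u = (\<lambda>x. cnj (u (- x)))"

lemma measurable_haar [simp]: "measurable \<mu> N = measurable borel N"
  by (rule measurable_cong_sets) simp_all

lemma measure_UNIV [simp]: "measure \<mu> UNIV = 1"
  using prob_space by simp

lemma L2_borel: "u \<in> L2 \<Longrightarrow> u \<in> borel_measurable borel"
  using L2_measurable[of u \<mu>] by simp

lemma continuous_L2:
  assumes "continuous_on UNIV u"
  shows "u \<in> L2"
proof -
  have "compact (range u)"
    using assms compact_group by (rule compact_continuous_image)
  then obtain B where "\<And>x. cmod (u x) \<le> B"
    using compact_imp_bounded bounded_iff by (metis rangeI)
  then show ?thesis
    using assms by (intro L2_of_bounded) (auto intro: finite_measure_axioms borel_measurable_continuous_onI)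
qed

lemma invol_invol [simp]: "invol (invol u) = u"
  by (simp add: invol_def)

lemma translate_translate: "translate a (translate b u) = translate (a + b) u"
  by (simp add: translate_def minus_add add.assoc del: add_uminus_conv_diff)

lemma translate_0 [simp]: "translate 0 u = u"
  by (simp add: translate_def)

lemma translate_L2: "u \<in> L2 \<Longrightarrow> translate a u \<in> L2"
  using integrable_left[of "\<lambda>x. (cmod (u x))\<^sup>2" "- a"]
  by (auto simp: L2_space_def translate_def)

lemma invol_L2: "u \<in> L2 \<Longrightarrow> invol u \<in> L2"
  using integrable_uminus[of "\<lambda>x. (cmod (u x))\<^sup>2"]
  by (auto simp: L2_space_def invol_def)

lemma ip_translate:
  assumes "u \<in> L2" "v \<in> L2"
  shows "ip (translate a u) (translate a v) = ip u v"
  using integral_left[of "\<lambda>x. u x * cnj (v x)" "- a"] L2_borel[OF assms(1)] L2_borel[OF assms(2)]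
  by (simp add: L2_inner_def translate_def)

lemma ip_invol:
  assumes "u \<in> L2" "v \<in> L2"
  shows "ip (invol u) (invol v) = ip v u"
  using integral_uminus[of "\<lambda>x. cnj (u x) * v x"] L2_borel[OF assms(1)] L2_borel[OF assms(2)]
  by (simp add: L2_inner_def invol_def mult.commute)

lemma nrm_eqI: "ip u u = ip v v \<Longrightarrow> nrm u = nrm v"
  unfolding L2_inner_self of_real_eq_iff by (simp add: power2_eq_iff_nonneg)

lemma nrm_translate: "u \<in> L2 \<Longrightarrow> nrm (translate a u) = nrm u"
  by (intro nrm_eqI ip_translate)

lemma nrm_invol: "u \<in> L2 \<Longrightarrow> nrm (invol u) = nrm u"
  by (intro nrm_eqI ip_invol)

text \<open>
  A value of a convolution is an inner product with a translate. This form yields the bounds by the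
  Cauchy-Schwarz inequality, and the behaviour under translation and involution by invariance of the inner product.
\<close>

lemma conv_eq_ip: "(u \<star> v) x = ip u (translate x (invol v))"
  by (simp add: group_convolution_def L2_inner_def translate_def invol_def minus_add)

lemma conv_0: "(u \<star> v) 0 = ip u (invol v)"
  by (simp add: conv_eq_ip)

lemma ip_translate_eq_conv: "ip u (translate x v) = (u \<star> invol v) x"
  by (simp add: conv_eq_ip)

lemma conv_bound:
  assumes "u \<in> L2" "v \<in> L2"
  shows "cmod ((u \<star> v) x) \<le> nrm u * nrm v"
  using L2_inner_le[of u \<mu> "translate x (invol v)"] assms
  by (simp add: conv_eq_ip translate_L2 invol_L2 nrm_translate nrm_invol)

lemma conv_measurable:
  assumes "u \<in> L2" "v \<in> L2"
  shows "u \<star> v \<in> borel_measurable borel"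
proof -
  have [measurable]: "u \<in> borel_measurable borel" "v \<in> borel_measurable borel"
    using assms by (auto intro: L2_borel)
  show ?thesis
    unfolding group_convolution_def[abs_def] by measurable
qed

lemma conv_L2:
  assumes "u \<in> L2" "v \<in> L2"
  shows "u \<star> v \<in> L2"
  using conv_bound[OF assms] conv_measurable[OF assms]
  by (intro L2_of_bounded) (auto intro: finite_measure_axioms)

lemma nrm_le_of_bound:
  assumes "u \<in> L2" "0 \<le> B" "\<And>x. cmod (u x) \<le> B"
  shows "nrm u \<le> B"
proof (rule power2_le_imp_le)
  have "(nrm u)\<^sup>2 \<le> (LINT x|\<mu>. B\<^sup>2)"
    unfolding L2_norm_squared using assms
    by (intro integral_mono L2_square_integrable power_mono) auto
  then show "(nrm u)\<^sup>2 \<le> B\<^sup>2"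
    by simp
qed (rule assms)

lemma nrm_conv_le:
  assumes "u \<in> L2" "v \<in> L2"
  shows "nrm (u \<star> v) \<le> nrm u * nrm v"
  using conv_bound[OF assms] by (intro nrm_le_of_bound conv_L2 assms) auto

lemma conv_translate:
  assumes "u \<in> L2" "v \<in> L2"
  shows "translate a (u \<star> v) = translate a u \<star> v"
proof
  fix x
  have "ip u (translate (- a + x) (invol v)) = ip (translate a u) (translate a (translate (- a + x) (invol v)))"
    using assms by (subst ip_translate) (auto intro: translate_L2 invol_L2)
  then show "translate a (u \<star> v) x = (translate a u \<star> v) x"
    by (simp add: translate_def[of a "u \<star> v"] conv_eq_ip translate_translate)
qed

lemma conv_invol:
  assumes "u \<in> L2" "v \<in> L2"
  shows "invol (u \<star> v) = invol v \<star> invol u"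
proof
  fix x
  have "ip u (translate (- x) (invol v)) = ip (translate x u) (translate x (translate (- x) (invol v)))"
    using assms by (subst ip_translate) (auto intro: translate_L2 invol_L2)
  then have "(u \<star> v) (- x) = ip (translate x u) (invol v)"
    by (simp add: conv_eq_ip translate_translate)
  then show "invol (u \<star> v) x = (invol v \<star> invol u) x"
    by (subst invol_def) (simp add: conv_eq_ip L2_inner_commute[symmetric])
qed

text \<open>
  Both sides are the double integral of \<open>u y * v (- y + x) * cnj (w x)\<close>. It converges absolutely because
  the convolution of \<open>\<bar>u\<bar>\<close> and \<open>\<bar>v\<bar>\<close> is again square-integrable.
\<close>

lemma conv_adjoint:
  assumes u: "u \<in> L2" and v: "v \<in> L2" and w: "w \<in> L2"
  shows "ip (u \<star> v) w = ip u (w \<star> invol v)"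
proof -
  have [measurable]: "u \<in> borel_measurable borel" "v \<in> borel_measurable borel" "w \<in> borel_measurable borel"
    using assms by (auto intro: L2_borel)
  define F where "F = (\<lambda>(x, y). u y * v (- y + x) * cnj (w x))"
  have slice: "(\<lambda>y. v (- y + x)) \<in> L2" for x
    using L2_cnj[OF translate_L2[OF invol_L2[OF v], of x]]
    by (simp add: translate_def invol_def minus_add)
  define u' v' where "u' = (\<lambda>x. complex_of_real (cmod (u x)))" and "v' = (\<lambda>x. complex_of_real (cmod (v x)))"
  have u'v': "u' \<in> L2" "v' \<in> L2"
    using u v by (auto simp: u'_def v'_def L2_of_real_norm)
  have "integrable (\<mu> \<Otimes>\<^sub>M \<mu>) F"
  proof (rule Fubini_integrable)
    show "F \<in> borel_measurable (\<mu> \<Otimes>\<^sub>M \<mu>)"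
      unfolding F_def by measurable
    have "(LINT y|\<mu>. norm (F (x, y))) = cmod (w x) * cmod ((u' \<star> v') x)" for x
    proof -
      have "(u' \<star> v') x = complex_of_real (LINT y|\<mu>. cmod (u y) * cmod (v (- y + x)))"
        unfolding group_convolution_def u'_def v'_def
        by (simp add: integral_complex_of_real[symmetric] del: integral_complex_of_real)
      then have "cmod ((u' \<star> v') x) = (LINT y|\<mu>. cmod (u y) * cmod (v (- y + x)))"
        by simp
      moreover have "(LINT y|\<mu>. norm (F (x, y))) = (LINT y|\<mu>. cmod (w x) * (cmod (u y) * cmod (v (- y + x))))"
        unfolding F_def by (intro Bochner_Integration.integral_cong) (auto simp: norm_mult)
      ultimately show ?thesis by simp
    qed
    then show "integrable \<mu> (\<lambda>x. LINT y|\<mu>. norm (F (x, y)))"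
      using L2_norm_mult_integrable[OF w conv_L2[OF u'v']] by simp
    show "AE x in \<mu>. integrable \<mu> (\<lambda>y. F (x, y))"
      using L2_mult_integrable[OF u slice] by (simp add: F_def)
  qed
  then have "integrable (\<mu> \<Otimes>\<^sub>M \<mu>) (case_prod (\<lambda>x y. u y * v (- y + x) * cnj (w x)))"
    by (simp add: F_def)
  from Fubini_integral[OF this]
  have "(LINT y|\<mu>. LINT x|\<mu>. u y * v (- y + x) * cnj (w x)) = (LINT x|\<mu>. LINT y|\<mu>. u y * v (- y + x) * cnj (w x))" .
  also have "\<dots> = ip (u \<star> v) w"
    by (simp add: L2_inner_def group_convolution_def)
  also have "(LINT y|\<mu>. LINT x|\<mu>. u y * v (- y + x) * cnj (w x)) = ip u (w \<star> invol v)"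
  proof -
    have "cnj ((w \<star> invol v) y) = (LINT x|\<mu>. v (- y + x) * cnj (w x))" for y
      unfolding group_convolution_def invol_def
      by (subst Bochner_Integration.integral_cnj[symmetric]) (simp add: minus_add mult.commute)
    then show ?thesis
      by (simp add: L2_inner_def mult.assoc)
  qed
  finally show ?thesis by simp
qed

lemma conv_assoc:
  assumes u: "u \<in> L2" and v: "v \<in> L2" and w: "w \<in> L2"
  shows "(u \<star> v) \<star> w = u \<star> (v \<star> w)"
proof
  fix x
  have "((u \<star> v) \<star> w) x = ip u (translate x (invol w) \<star> invol v)"
    unfolding conv_eq_ip[of "u \<star> v"] using assms by (intro conv_adjoint translate_L2 invol_L2)
  also have "\<dots> = ip u (translate x (invol (v \<star> w)))"
    using assms by (simp add: conv_translate conv_invol invol_L2)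
  finally show "((u \<star> v) \<star> w) x = (u \<star> (v \<star> w)) x"
    by (simp add: conv_eq_ip)
qed

lemma conv_scale_left: "(\<lambda>x. c * u x) \<star> v = (\<lambda>x. c * (u \<star> v) x)"
  by (simp add: fun_eq_iff conv_eq_ip L2_inner_scale_left)

lemma
  assumes "u \<in> L2" "u' \<in> L2" "v \<in> L2"
  shows conv_add_left: "(\<lambda>x. u x + u' x) \<star> v = (\<lambda>x. (u \<star> v) x + (u' \<star> v) x)"
    and conv_diff_left: "(\<lambda>x. u x - u' x) \<star> v = (\<lambda>x. (u \<star> v) x - (u' \<star> v) x)"
  using assms
  by (simp_all add: fun_eq_iff conv_eq_ip L2_inner_add_left L2_inner_diff_left translate_L2 invol_L2)

lemma conv_diff_right:
  assumes "u \<in> L2" "v \<in> L2" "v' \<in> L2"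
  shows "u \<star> (\<lambda>x. v x - v' x) = (\<lambda>x. (u \<star> v) x - (u \<star> v') x)"
proof
  fix x
  have "translate x (invol (\<lambda>x. v x - v' x)) = (\<lambda>y. translate x (invol v) y - translate x (invol v') y)"
    by (simp add: translate_def invol_def)
  then show "(u \<star> (\<lambda>x. v x - v' x)) x = (u \<star> v) x - (u \<star> v') x"
    using assms by (simp add: conv_eq_ip L2_inner_diff_right translate_L2 invol_L2)
qed

text \<open>
  If \<open>\<phi>\<close> is continuous, then it is uniformly continuous, and since \<open>dist\<close> is invariant under left translation,
  \<open>u \<star> \<phi>\<close> inherits the modulus of continuity. In general, approximate \<open>v\<close> in \<open>L\<^sup>2\<close> by continuous functions; the
  convolutions then converge uniformly.
\<close>

lemma conv_continuous:
  assumes u: "u \<in> L2" and v: "v \<in> L2"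
  shows "continuous_on UNIV (u \<star> v)"
proof -
  have step: "continuous_on UNIV (u \<star> \<phi>)" if \<phi>: "continuous_on UNIV \<phi>" for \<phi>
  proof -
    have \<phi>2: "\<phi> \<in> L2"
      by (rule continuous_L2[OF \<phi>])
    have uc: "uniformly_continuous_on UNIV \<phi>"
      using compact_uniformly_continuous[OF \<phi> compact_group] .
    have "\<exists>d>0. \<forall>x'. dist x' x < d \<longrightarrow> dist ((u \<star> \<phi>) x') ((u \<star> \<phi>) x) < \<epsilon>"
      if "\<epsilon> > 0" for x and \<epsilon> :: real
    proof -
      \<comment> \<open>the summand 1 keeps the quotient meaningful when \<open>nrm u = 0\<close>\<close>
      define \<delta> where "\<delta> = \<epsilon> / (nrm u + 1)"
      have pos: "nrm u + 1 > 0"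
        by (simp add: add_nonneg_pos)
      then have \<delta>: "\<delta> > 0"
        using that by (simp add: \<delta>_def)
      have "nrm u * \<delta> = \<epsilon> - \<delta>"
        using pos by (simp add: \<delta>_def field_simps)
      then have \<delta>': "nrm u * \<delta> < \<epsilon>"
        using \<delta> by simp
      from uc \<delta> obtain d where d: "d > 0" "\<And>x x'. dist x' x < d \<Longrightarrow> dist (\<phi> x') (\<phi> x) < \<delta>"
        unfolding uniformly_continuous_on_def by (metis UNIV_I)
      have "dist ((u \<star> \<phi>) x') ((u \<star> \<phi>) x) < \<epsilon>" if x': "dist x' x < d" for x'
      proof -
        let ?D = "\<lambda>y. translate x' (invol \<phi>) y - translate x (invol \<phi>) y"
        have D2: "?D \<in> L2"
          by (intro L2_diff translate_L2 invol_L2 \<phi>2)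
        have "cmod (?D y) \<le> \<delta>" for y
        proof -
          have "dist (\<phi> (- y + x')) (\<phi> (- y + x)) < \<delta>"
            using x' by (intro d(2)) simp
          moreover have "?D y = cnj (\<phi> (- y + x') - \<phi> (- y + x))"
            by (simp add: translate_def invol_def minus_add)
          ultimately show ?thesis
            by (simp only: complex_mod_cnj dist_norm)
        qed
        then have "nrm ?D \<le> \<delta>"
          using \<delta> by (intro nrm_le_of_bound D2) auto
        have "dist ((u \<star> \<phi>) x') ((u \<star> \<phi>) x) = cmod (ip u ?D)"
          using u \<phi>2 by (simp add: dist_norm conv_eq_ip L2_inner_diff_right translate_L2 invol_L2)
        also have "\<dots> \<le> nrm u * nrm ?D"
          by (rule L2_inner_le[OF u D2])
        also have "\<dots> \<le> nrm u * \<delta>"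
          using \<open>nrm ?D \<le> \<delta>\<close> by (intro mult_left_mono) auto
        finally show ?thesis
          using \<delta>' by simp
      qed
      with d(1) show ?thesis by blast
    qed
    then show ?thesis
      by (simp add: continuous_on_iff)
  qed
  have cl: "v \<in> continuous_L2_closure \<mu>"
    by (rule continuous_dense_L2[OF finite_measure_axioms _ v]) simp
  have "\<forall>n. \<exists>\<phi>. continuous_on UNIV \<phi> \<and> nrm (\<lambda>x. v x - \<phi> x) < inverse (real (Suc n))"
  proof
    fix n
    have "0 < inverse (real (Suc n))" by simp
    then obtain \<phi> where "continuous_on UNIV \<phi>" "nrm (\<lambda>x. v x - \<phi> x) < inverse (real (Suc n))"
      by (rule continuous_L2_closureE[OF cl])
    then show "\<exists>\<phi>. continuous_on UNIV \<phi> \<and> nrm (\<lambda>x. v x - \<phi> x) < inverse (real (Suc n))"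
      by (intro exI[of _ \<phi>] conjI)
  qed
  from choice[OF this] obtain \<phi> where "\<forall>n. continuous_on UNIV (\<phi> n) \<and>
      nrm (\<lambda>x. v x - \<phi> n x) < inverse (real (Suc n))" ..
  then have \<phi>: "\<And>n. continuous_on UNIV (\<phi> n)"
    "\<And>n. nrm (\<lambda>x. v x - \<phi> n x) < inverse (real (Suc n))"
    by simp_all
  have "uniform_limit UNIV (\<lambda>n. u \<star> \<phi> n) (u \<star> v) sequentially"
  proof (rule uniform_limitI)
    fix e :: real assume e: "e > 0"
    have "(\<lambda>n. nrm u * inverse (real (Suc n))) \<longlonglongrightarrow> nrm u * 0"
      by (intro tendsto_intros LIMSEQ_inverse_real_of_nat)
    then have "eventually (\<lambda>n. nrm u * inverse (real (Suc n)) < e) sequentially"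
      using e by (intro order_tendstoD) auto
    then show "eventually (\<lambda>n. \<forall>x\<in>UNIV. dist ((u \<star> \<phi> n) x) ((u \<star> v) x) < e) sequentially"
    proof eventually_elim
      case (elim n)
      have "dist ((u \<star> \<phi> n) x) ((u \<star> v) x) < e" for x
      proof -
        have "dist ((u \<star> \<phi> n) x) ((u \<star> v) x) = cmod ((u \<star> (\<lambda>x. v x - \<phi> n x)) x)"
          using u v continuous_L2[OF \<phi>(1)] by (simp add: conv_diff_right dist_norm norm_minus_commute)
        also have "\<dots> \<le> nrm u * nrm (\<lambda>x. v x - \<phi> n x)"
          by (intro conv_bound u L2_diff v continuous_L2 \<phi>)
        also have "\<dots> \<le> nrm u * inverse (real (Suc n))"
          using \<phi>(2)[of n] by (intro mult_left_mono) auto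
        finally show ?thesis using elim by simp
      qed
      then show ?case by simp
    qed
  qed
  then show ?thesis
    by (rule uniform_limit_theorem[OF always_eventually[OF allI[OF step[OF \<phi>(1)]]]]) simp
qed

end

section \<open>Eigenfunctions by power iteration\<close>

text \<open>
  The quotients \<open>N (Suc n) / N n\<close> increase by log-convexity and are bounded by \<open>N 0\<close>; \<open>\<Lambda>\<close> is their
  limit. The lower bound \<open>\<Lambda> ^ Suc n \<le> N n\<close> prevents the normalised sequence from tending to \<open>0\<close>. For
  \<open>N n = \<parallel>h^(n+1)\<parallel>\<^sup>2\<close> it expresses that the top eigenvalue has multiplicity at least one.
\<close>

lemma log_convex_growth_rate:
  fixes N :: "nat \<Rightarrow> real"
  assumes pos: "\<And>n. N n > 0"
    and log_convex: "\<And>n. (N (Suc n))\<^sup>2 \<le> N n * N (Suc (Suc n))"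
    and submult: "\<And>a b. N (Suc (a + b)) \<le> N a * N b"
  shows "\<exists>\<Lambda>>0. (\<forall>n. N (Suc n) \<le> \<Lambda> * N n) \<and> (\<forall>n. \<Lambda> ^ Suc n \<le> N n) \<and>
    convergent (\<lambda>n. N n / \<Lambda> ^ n)"
proof -
  define r where "r n = N (Suc n) / N n" for n
  have rpos: "r n > 0" for n
    using pos by (simp add: r_def)
  have N_Suc: "N (Suc n) = r n * N n" for n
    using pos[of n] by (simp add: r_def)
  have "r n \<le> r (Suc n)" for n
    using log_convex[of n] pos[of n] pos[of "Suc n"] by (simp add: r_def field_simps power2_eq_square)
  then have inc: "incseq r"
    by (rule incseq_SucI)
  have bdd: "r n \<le> N 0" for n
    using submult[of n 0] pos[of n] by (simp add: r_def field_simps)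
  obtain \<Lambda> where lim: "r \<longlonglongrightarrow> \<Lambda>" and le: "\<And>n. r n \<le> \<Lambda>"
    using incseq_convergent[OF inc, of "N 0"] bdd by auto
  have \<Lambda>: "\<Lambda> > 0"
    using le[of 0] rpos[of 0] by simp
  have step: "N (Suc n) \<le> \<Lambda> * N n" for n
    unfolding N_Suc using le[of n] pos[of n] by (intro mult_right_mono) auto
  have "\<Lambda> ^ Suc n \<le> N n" for n
  proof (rule LIMSEQ_le_const2)
    show "(\<lambda>b. r b ^ Suc n) \<longlonglongrightarrow> \<Lambda> ^ Suc n"
      by (intro tendsto_power lim)
    \<comment> \<open>\<open>N n\<close> is at least a product of \<open>Suc n\<close> consecutive quotients starting at \<open>b\<close>, for arbitrarily large \<open>b\<close>\<close>
    have "r b ^ Suc n \<le> N n" for b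
    proof -
      have "r b ^ m * N b \<le> N (m + b)" for m
      proof (induction m)
        case (Suc m)
        have "r b ^ Suc m * N b \<le> r b * N (m + b)"
          using Suc rpos[of b] by (simp add: mult.assoc)
        also have "\<dots> \<le> r (m + b) * N (m + b)"
          using pos[of "m + b"] incseqD[OF inc, of b "m + b"] by (intro mult_right_mono) auto
        finally show ?case
          by (simp add: N_Suc)
      qed simp
      from this[of "Suc n"] have "r b ^ Suc n * N b \<le> N n * N b"
        using submult[of n b] by simp
      then show ?thesis
        using pos[of b] by simp
    qed
    then show "\<exists>M. \<forall>b\<ge>M. r b ^ Suc n \<le> N n"
      by blast
  qed
  moreover have "convergent (\<lambda>n. N n / \<Lambda> ^ n)"
  proof -
    have "decseq (\<lambda>n. N n / \<Lambda> ^ n)"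
      using step \<Lambda> by (intro decseq_SucI) (simp add: field_simps)
    moreover have "0 \<le> N n / \<Lambda> ^ n" for n
      using pos[of n] \<Lambda> by simp
    ultimately show ?thesis
      using decseq_convergent[of "\<lambda>n. N n / \<Lambda> ^ n" 0] convergentI by metis
  qed
  ultimately show ?thesis
    using \<Lambda> step by blast
qed

context compact_metric_group
begin

lemma conv_square_self_adjoint:
  assumes "g \<in> L2" "u \<in> L2" "w \<in> L2"
  shows "ip (u \<star> (g \<star> invol g)) w = ip u (w \<star> (g \<star> invol g))"
  using assms by (simp add: conv_adjoint conv_L2 conv_invol invol_L2)

text \<open>
  With \<open>w = u\<close> this says that convolution by \<open>g \<star> invol g\<close> is a positive operator.
\<close>

lemma conv_square_inner:
  assumes g: "g \<in> L2" and u: "u \<in> L2" and w: "w \<in> L2"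
  shows "ip (u \<star> (g \<star> invol g)) w = ip (u \<star> g) (w \<star> g)"
  using assms by (simp add: conv_assoc[symmetric] conv_adjoint[of "u \<star> g"] conv_L2 invol_L2)

text \<open>
  Let \<open>h = g \<star> invol g\<close>. The squared norms \<open>\<parallel>h^n\<parallel>\<^sup>2\<close> of the convolution powers are log-convex and submultiplicative,
  so they grow like \<open>\<Lambda> ^ n\<close>, where \<open>\<Lambda>\<close> is the square of the largest eigenvalue; \<open>f\<close> witnesses \<open>t\<^sup>2 < \<Lambda>\<close>. All inner
  products of even powers are again such norms, so \<open>h^(2n+2) / \<Lambda> ^ n\<close> is a Cauchy sequence in \<open>L\<^sup>2\<close>.
  By \<open>conv_bound\<close>, one more convolution makes it a Cauchy sequence for uniform convergence.
\<close>

lemma eigenfunction_exists: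
  assumes g: "g \<in> L2" and f: "f \<in> L2" and t: "0 \<le> t" and gap: "t * (nrm f)\<^sup>2 < (nrm (f \<star> g))\<^sup>2"
  obtains l e where "t < l" "e \<in> L2" "nrm e \<noteq> 0" "e \<star> (g \<star> invol g) = (\<lambda>x. of_real l * e x)"
proof -
  define h where "h = g \<star> invol g"
  have h: "h \<in> L2"
    unfolding h_def by (intro conv_L2 g invol_L2)
  have sa: "ip (u \<star> h) w = ip u (w \<star> h)" if "u \<in> L2" "w \<in> L2" for u w
    unfolding h_def by (rule conv_square_self_adjoint[OF g that])
  \<comment> \<open>the convolution power with \<open>n + 1\<close> factors; there need not be a unit to start from\<close>
  define q where "q n = ((\<lambda>u. u \<star> h) ^^ n) h" for n
  have q0: "q 0 = h" and q_Suc: "q (Suc n) = q n \<star> h" for n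
    by (simp_all add: q_def)
  have q [simp]: "q n \<in> L2" for n
    by (induction n) (simp_all add: q0 q_Suc h conv_L2)
  have q_shift: "ip (q (Suc a)) (q b) = ip (q a) (q (Suc b))" for a b
    by (simp add: q_Suc sa)
  have q_conv: "q (Suc (a + b)) = q a \<star> q b" for a b
  proof (induction b)
    case (Suc b)
    have "q a \<star> q (Suc b) = (q a \<star> q b) \<star> h"
      by (simp add: q_Suc conv_assoc h)
    then show ?case
      using Suc by (simp add: q_Suc[of "Suc (a + b)"])
  qed (simp add: q0 q_Suc)
  define N where "N n = (nrm (q n))\<^sup>2" for n
  \<comment> \<open>the inner product of two powers depends only on the total number of factors, here an even one\<close>
  have q_inner: "ip (q (n + m)) (q n) = of_real (N k)" if "m + 2 * n = 2 * k" for n m k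
    using that
  proof (induction m arbitrary: n rule: less_induct)
    case (less m)
    show ?case
    proof (cases "m = 0")
      case True
      then show ?thesis
        using less.prems by (simp add: N_def L2_inner_self)
    next
      case False
      moreover have "even m"
        using less.prems by presburger
      ultimately obtain m' where m: "m = Suc (Suc m')"
        by (metis even_Suc not0_implies_Suc odd_one One_nat_def)
      have "ip (q (n + m)) (q n) = ip (q (Suc n + m')) (q (Suc n))"
        using q_shift[of "Suc n + m'" n] by (simp add: m)
      also have "\<dots> = of_real (N k)"
        using less.prems by (intro less.IH) (simp_all add: m)
      finally show ?thesis .
    qed
  qed

  \<comment> \<open>the spectral radius of convolution by \<open>h\<close> exceeds \<open>t\<close>\<close>
  have "nrm f \<noteq> 0"
  proof
    assume "nrm f = 0"
    then have "nrm (f \<star> g) \<le> 0"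
      using nrm_conv_le[OF f g] by simp
    then show False
      using gap \<open>nrm f = 0\<close> by (simp add: antisym)
  qed
  then have f0: "nrm f > 0"
    by (simp add: less_le)
  define s where "s = (nrm (f \<star> g))\<^sup>2 / (nrm f)\<^sup>2"
  have ts: "t < s"
    using gap f0 by (simp add: s_def field_simps)
  then have s: "s > 0"
    using t by simp
  define \<alpha> where "\<alpha> n = nrm (f \<star> q n)" for n
  have fq: "f \<star> q n \<in> L2" for n
    by (intro conv_L2 f) simp
  have fq_Suc: "f \<star> q (Suc n) = (f \<star> q n) \<star> h" for n
    using conv_assoc[OF f q h] by (simp add: q_Suc)
  have \<alpha>0: "s * nrm f \<le> \<alpha> 0"
  proof -
    have "complex_of_real ((nrm (f \<star> g))\<^sup>2) = ip (f \<star> h) f"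
      unfolding h_def conv_square_inner[OF g f f] by (rule L2_inner_self[symmetric])
    then have "(nrm (f \<star> g))\<^sup>2 = cmod (ip (f \<star> h) f)"
      by (metis norm_of_real abs_of_nonneg zero_le_power2)
    also have "\<dots> \<le> \<alpha> 0 * nrm f"
      unfolding \<alpha>_def q0 by (intro L2_inner_le conv_L2 f h)
    finally show ?thesis
      using f0 by (simp add: s_def field_simps power2_eq_square)
  qed
  \<comment> \<open>the ratio \<open>s\<close> of the first step of the iteration persists by log-convexity\<close>
  have \<alpha>_lc: "(\<alpha> (Suc n))\<^sup>2 \<le> \<alpha> n * \<alpha> (Suc (Suc n))" for n
  proof -
    have "complex_of_real ((\<alpha> (Suc n))\<^sup>2) = ip (f \<star> q n) (f \<star> q (Suc (Suc n)))"
      unfolding \<alpha>_def L2_inner_self[symmetric] fq_Suc[of "Suc n"]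
      by (subst fq_Suc) (rule sa[OF fq fq])
    then have "(\<alpha> (Suc n))\<^sup>2 = cmod (ip (f \<star> q n) (f \<star> q (Suc (Suc n))))"
      by (metis norm_of_real abs_of_nonneg zero_le_power2)
    also have "\<dots> \<le> \<alpha> n * \<alpha> (Suc (Suc n))"
      unfolding \<alpha>_def by (intro L2_inner_le fq)
    finally show ?thesis .
  qed
  have \<alpha>_step: "\<alpha> n > 0 \<and> s * \<alpha> n \<le> \<alpha> (Suc n)" for n
  proof (induction n)
    case 0
    have \<alpha>0': "\<alpha> 0 > 0"
      using \<alpha>0 mult_pos_pos[OF s f0] by linarith
    have "complex_of_real ((\<alpha> 0)\<^sup>2) = ip f (f \<star> q 1)"
      unfolding \<alpha>_def L2_inner_self[symmetric] One_nat_def fq_Suc q0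
      by (rule sa[OF f conv_L2[OF f h]])
    then have "(\<alpha> 0)\<^sup>2 = cmod (ip f (f \<star> q 1))"
      by (metis norm_of_real abs_of_nonneg zero_le_power2)
    also have "\<dots> \<le> nrm f * \<alpha> 1"
      unfolding \<alpha>_def by (intro L2_inner_le f fq)
    finally have "(s * nrm f) * \<alpha> 0 \<le> nrm f * \<alpha> 1"
      using mult_right_mono[OF \<alpha>0, of "\<alpha> 0"] \<alpha>0' unfolding power2_eq_square by linarith
    then show ?case
      using \<alpha>0' f0 by (simp add: mult.assoc mult.left_commute)
  next
    case (Suc n)
    have pos: "\<alpha> (Suc n) > 0"
      using Suc mult_pos_pos[OF s, of "\<alpha> n"] by linarith
    have "(s * \<alpha> n) * \<alpha> (Suc n) \<le> \<alpha> n * \<alpha> (Suc (Suc n))"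
      using \<alpha>_lc[of n] mult_right_mono[of "s * \<alpha> n" "\<alpha> (Suc n)" "\<alpha> (Suc n)"] Suc pos
      unfolding power2_eq_square by linarith
    then show ?case
      using pos Suc by (simp add: mult.assoc mult.left_commute)
  qed
  have \<alpha>_ge: "s ^ Suc n * nrm f \<le> \<alpha> n" for n
  proof (induction n)
    case (Suc n)
    have "s ^ Suc (Suc n) * nrm f \<le> s * \<alpha> n"
      using Suc s by (simp add: mult.assoc)
    then show ?case
      using \<alpha>_step[of n] by simp
  qed (use \<alpha>0 in simp)
  have q_ge: "s ^ Suc n \<le> nrm (q n)" for n
  proof -
    have "s ^ Suc n * nrm f \<le> nrm f * nrm (q n)"
      using \<alpha>_ge[of n] nrm_conv_le[OF f q, of n] by (simp add: \<alpha>_def)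
    then show ?thesis
      using f0 by (simp add: mult.commute)
  qed
  have N_ge: "(s\<^sup>2) ^ Suc n \<le> N n" for n
  proof -
    have "(s\<^sup>2) ^ Suc n = (s ^ Suc n)\<^sup>2"
      by (simp only: power_mult[symmetric] mult.commute)
    then show ?thesis
      unfolding N_def using power_mono[OF q_ge[of n], of 2] s by simp
  qed

  have N_pos: "N n > 0" for n
  proof -
    have "0 < (s\<^sup>2) ^ Suc n"
      using s by simp
    then show ?thesis
      using N_ge[of n] by linarith
  qed
  have N_log_convex: "(N (Suc n))\<^sup>2 \<le> N n * N (Suc (Suc n))" for n
  proof -
    have "ip (q (n + 2)) (q n) = complex_of_real (N (Suc n))"
      by (rule q_inner) simp
    then have "cmod (ip (q (n + 2)) (q n)) = \<bar>N (Suc n)\<bar>"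
      by (simp only: norm_of_real)
    then have "N (Suc n) \<le> nrm (q (n + 2)) * nrm (q n)"
      using L2_inner_le[OF q q, of "n + 2" n] by linarith
    then have "(N (Suc n))\<^sup>2 \<le> (nrm (q (n + 2)) * nrm (q n))\<^sup>2"
      by (intro power_mono) (simp_all add: N_def)
    then show ?thesis
      by (simp add: N_def power_mult_distrib mult.commute)
  qed
  have N_submult: "N (Suc (a + b)) \<le> N a * N b" for a b
    using power_mono[OF nrm_conv_le[OF q q, of a b], of 2]
    by (simp add: N_def q_conv power_mult_distrib)
  obtain \<Lambda> where \<Lambda>: "\<Lambda> > 0" and N_step: "\<And>n. N (Suc n) \<le> \<Lambda> * N n"
    and N_lower: "\<And>n. \<Lambda> ^ Suc n \<le> N n" and conv: "convergent (\<lambda>n. N n / \<Lambda> ^ n)"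
    using log_convex_growth_rate[of N, OF N_pos N_log_convex N_submult] by auto
  have s_\<Lambda>: "s\<^sup>2 \<le> \<Lambda>"
  proof (rule ccontr)
    assume "\<not> s\<^sup>2 \<le> \<Lambda>"
    then have "1 < s\<^sup>2 / \<Lambda>"
      using \<Lambda> by simp
    moreover have "N n \<le> N 0 * \<Lambda> ^ n" for n
    proof (induction n)
      case (Suc n)
      have "N (Suc n) \<le> \<Lambda> * (N 0 * \<Lambda> ^ n)"
        using N_step[of n] mult_left_mono[OF Suc, of \<Lambda>] \<Lambda> by linarith
      then show ?case
        by (simp add: mult.left_commute)
    qed simp
    then have "s\<^sup>2 * (s\<^sup>2 / \<Lambda>) ^ n \<le> N 0" for n
      using order_trans[OF N_ge[of n]] \<Lambda> by (simp add: power_divide field_simps)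
    then have "(s\<^sup>2 / \<Lambda>) ^ n \<le> N 0 / s\<^sup>2" for n
      using s by (simp add: field_simps)
    ultimately show False
      using real_arch_pow[of "s\<^sup>2 / \<Lambda>" "N 0 / s\<^sup>2"] by (meson not_less)
  qed

  \<comment> \<open>only even powers, for which the inner products are values of \<open>N\<close>\<close>
  define e where "e n = (\<lambda>x. complex_of_real (1 / \<Lambda> ^ n) * q (Suc (2 * n)) x)" for n
  have e [simp]: "e n \<in> L2" for n
    unfolding e_def by (intro L2_scale) simp
  define k where "k = h \<star> h"
  have k: "k \<in> L2"
    unfolding k_def by (intro conv_L2 h)
  have e_Suc: "e (Suc n) x = of_real (1 / \<Lambda>) * (e n \<star> k) x" for n x
  proof -
    have "q (Suc (2 * Suc n)) = q (Suc (2 * n)) \<star> k"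
      by (simp add: q_Suc k_def conv_assoc h conv_L2)
    moreover have "(e n \<star> k) x = of_real (1 / \<Lambda> ^ n) * (q (Suc (2 * n)) \<star> k) x"
      by (simp only: e_def conv_scale_left)
    ultimately show ?thesis
      by (simp add: e_def[of "Suc n"])
  qed
  define D where "D n = N (Suc n) / \<Lambda> ^ n" for n
  have "convergent D"
  proof -
    from conv obtain c where "(\<lambda>n. N n / \<Lambda> ^ n) \<longlonglongrightarrow> c"
      by (auto simp: convergent_def)
    then have "(\<lambda>n. \<Lambda> * (N (Suc n) / \<Lambda> ^ Suc n)) \<longlonglongrightarrow> \<Lambda> * c"
      by (intro tendsto_mult_left LIMSEQ_Suc)
    moreover have "\<Lambda> * (N (Suc n) / \<Lambda> ^ Suc n) = D n" for n
      using \<Lambda> by (simp add: D_def)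
    ultimately show ?thesis
      by (auto simp: convergent_def)
  qed
  then obtain d where d: "D \<longlonglongrightarrow> d"
    by (auto simp: convergent_def)
  have e_inner: "ip (e a) (e b) = of_real (D (a + b))" for a b
  proof -
    have "ip (q (Suc (2 * a))) (q (Suc (2 * b))) = of_real (N (Suc (a + b)))" if "b \<le> a" for a b
      using that q_inner[of "2 * a - 2 * b" "Suc (2 * b)" "Suc (a + b)"] by simp
    then have "ip (q (Suc (2 * a))) (q (Suc (2 * b))) = of_real (N (Suc (a + b)))" for a b
      using L2_inner_commute[of \<mu> "q (Suc (2 * a))" "q (Suc (2 * b))"]
      by (cases "b \<le> a") (simp_all add: add.commute)
    then show ?thesis
      by (simp only: e_def L2_inner_scale_left L2_inner_scale_right) (simp add: D_def power_add)
  qed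
  \<comment> \<open>the right-hand side tends to 0, as \<open>D\<close> converges\<close>
  have e_diff: "(nrm (\<lambda>x. e a x - e b x))\<^sup>2 = D (2 * a) - 2 * D (a + b) + D (2 * b)" for a b
  proof -
    have "complex_of_real ((nrm (\<lambda>x. e a x - e b x))\<^sup>2) = of_real (D (2 * a) - 2 * D (a + b) + D (2 * b))"
      unfolding L2_inner_self[symmetric] L2_inner_diff_left[OF e e L2_diff[OF e e]]
        L2_inner_diff_right[OF e e e] e_inner
      by (simp add: mult_2[symmetric] add.commute[of b a])
    then show ?thesis
      by (simp only: of_real_eq_iff)
  qed
  have "uniformly_Cauchy_on UNIV (\<lambda>n. e (Suc n))"
    unfolding uniformly_Cauchy_on_def
  proof (intro allI impI)
    fix \<epsilon> :: real assume \<epsilon>: "\<epsilon> > 0"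
    define \<delta> where "\<delta> = \<epsilon> * \<Lambda> / (nrm k + 1)"
    have k1: "nrm k + 1 > 0"
      by (simp add: add_nonneg_pos)
    then have \<delta>: "\<delta> > 0"
      using \<epsilon> \<Lambda> by (simp add: \<delta>_def)
    then have "eventually (\<lambda>n. \<bar>D n - d\<bar> < \<delta>\<^sup>2 / 4) sequentially"
      using tendstoD[OF d, of "\<delta>\<^sup>2 / 4"] by (simp add: dist_real_def)
    then obtain M where M: "\<And>n. n \<ge> M \<Longrightarrow> \<bar>D n - d\<bar> < \<delta>\<^sup>2 / 4"
      by (auto simp: eventually_sequentially)
    have "dist (e (Suc a) x) (e (Suc b) x) < \<epsilon>" if ab: "a \<ge> M" "b \<ge> M" for a b x
    proof -
      have "(nrm (\<lambda>x. e a x - e b x))\<^sup>2 < \<delta>\<^sup>2"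
      proof -
        have "\<bar>D (2 * a) - d\<bar> < \<delta>\<^sup>2 / 4" "\<bar>D (2 * b) - d\<bar> < \<delta>\<^sup>2 / 4" "\<bar>D (a + b) - d\<bar> < \<delta>\<^sup>2 / 4"
          using ab by (intro M; simp)+
        then show ?thesis
          unfolding e_diff by linarith
      qed
      then have nd: "nrm (\<lambda>x. e a x - e b x) < \<delta>"
        using \<delta> by (simp add: power_less_imp_less_base[of _ 2])
      have "dist (e (Suc a) x) (e (Suc b) x) = cmod (of_real (1 / \<Lambda>) * ((\<lambda>x. e a x - e b x) \<star> k) x)"
        by (simp add: e_Suc conv_diff_left k dist_norm right_diff_distrib)
      also have "\<dots> = 1 / \<Lambda> * cmod (((\<lambda>x. e a x - e b x) \<star> k) x)"
        using \<Lambda> by (simp add: norm_mult norm_divide)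
      also have "\<dots> \<le> 1 / \<Lambda> * (nrm (\<lambda>x. e a x - e b x) * nrm k)"
        using \<Lambda> by (intro mult_left_mono conv_bound L2_diff k) simp_all
      also have "\<dots> \<le> 1 / \<Lambda> * (\<delta> * nrm k)"
        using \<Lambda> nd by (intro mult_left_mono mult_right_mono) simp_all
      also have "\<dots> < 1 / \<Lambda> * (\<delta> * (nrm k + 1))"
        using \<Lambda> \<delta> by (intro mult_strict_left_mono) simp_all
      also have "\<dots> = \<epsilon>"
        using \<Lambda> k1 by (simp add: \<delta>_def)
      finally show ?thesis .
    qed
    then show "\<exists>M. \<forall>x\<in>UNIV. \<forall>m\<ge>M. \<forall>n\<ge>M. dist (e (Suc m) x) (e (Suc n) x) < \<epsilon>"
      by (intro exI[of _ M]) simp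
  qed
  from Cauchy_uniformly_convergent[OF this] obtain E
    where E_lim: "uniform_limit UNIV (\<lambda>n. e (Suc n)) E sequentially"
    unfolding uniformly_convergent_on_def ..
  have "continuous_on UNIV (e (Suc n))" for n
  proof -
    have "e (Suc n) = (\<lambda>x. of_real (1 / \<Lambda>) * (e n \<star> k) x)"
      by (rule ext) (rule e_Suc)
    then show ?thesis
      using conv_continuous[OF e k, of n] by (simp only:) (intro continuous_intros)
  qed
  then have "continuous_on UNIV E"
    by (intro uniform_limit_theorem[OF always_eventually[OF allI] E_lim]) simp_all
  then have E: "E \<in> L2"
    by (rule continuous_L2)
  have E_close: "(\<lambda>n. nrm (\<lambda>x. e (Suc n) x - E x)) \<longlonglongrightarrow> 0"
  proof (rule tendstoI)
    fix \<epsilon> :: real assume "\<epsilon> > 0"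
    then have "eventually (\<lambda>n. \<forall>x\<in>UNIV. dist (e (Suc n) x) (E x) < \<epsilon> / 2) sequentially"
      using uniform_limitD[OF E_lim, of "\<epsilon> / 2"] by simp
    then show "eventually (\<lambda>n. dist (nrm (\<lambda>x. e (Suc n) x - E x)) 0 < \<epsilon>) sequentially"
    proof eventually_elim
      case (elim n)
      have "nrm (\<lambda>x. e (Suc n) x - E x) \<le> \<epsilon> / 2"
        using elim \<open>\<epsilon> > 0\<close> by (intro nrm_le_of_bound L2_diff E e) (auto simp: dist_norm less_imp_le)
      then show ?case
        using \<open>\<epsilon> > 0\<close> by simp
    qed
  qed
  have E_pointwise: "(\<lambda>n. e (Suc n) x) \<longlonglongrightarrow> E x" for x
    using tendsto_uniform_limitI[OF E_lim] by simp
  have E_eigen: "(E \<star> k) x = of_real \<Lambda> * E x" for x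
  proof -
    have "(\<lambda>n. cmod ((e (Suc n) \<star> k) x - (E \<star> k) x)) \<longlonglongrightarrow> 0"
    proof (rule tendsto_sandwich[OF _ _ tendsto_const])
      have "(\<lambda>n. nrm (\<lambda>x. e (Suc n) x - E x) * nrm k) \<longlonglongrightarrow> 0 * nrm k"
        by (intro tendsto_mult E_close tendsto_const)
      then show "(\<lambda>n. nrm (\<lambda>x. e (Suc n) x - E x) * nrm k) \<longlonglongrightarrow> 0"
        by simp
      have "cmod ((e (Suc n) \<star> k) x - (E \<star> k) x) \<le> nrm (\<lambda>x. e (Suc n) x - E x) * nrm k" for n
        using conv_bound[OF L2_diff[OF e[of "Suc n"] E] k, of x] by (simp add: conv_diff_left E k)
      then show "eventually (\<lambda>n. cmod ((e (Suc n) \<star> k) x - (E \<star> k) x)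
          \<le> nrm (\<lambda>x. e (Suc n) x - E x) * nrm k) sequentially"
        by simp
    qed simp
    then have 1: "(\<lambda>n. (e (Suc n) \<star> k) x) \<longlonglongrightarrow> (E \<star> k) x"
      by (simp add: tendsto_norm_zero_iff LIM_zero_iff)
    have "(\<lambda>n. of_real \<Lambda> * e (Suc (Suc n)) x) \<longlonglongrightarrow> of_real \<Lambda> * E x"
      by (intro tendsto_mult_left LIMSEQ_Suc[OF E_pointwise])
    then have 2: "(\<lambda>n. (e (Suc n) \<star> k) x) \<longlonglongrightarrow> of_real \<Lambda> * E x"
      using \<Lambda> by (simp add: e_Suc[of "Suc _"])
    from LIMSEQ_unique[OF 1 2] show ?thesis .
  qed
  \<comment> \<open>here the lower bound on \<open>N\<close> is used: the limit does not vanish\<close>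
  have E_nz: "\<Lambda> \<le> nrm E"
  proof (rule LIMSEQ_le_const)
    have "(\<lambda>n. nrm E + nrm (\<lambda>x. e (Suc n) x - E x)) \<longlonglongrightarrow> nrm E + 0"
      by (intro tendsto_add tendsto_const E_close)
    then show "(\<lambda>n. nrm E + nrm (\<lambda>x. e (Suc n) x - E x)) \<longlonglongrightarrow> nrm E"
      by simp
    have "\<Lambda> \<le> nrm E + nrm (\<lambda>x. e (Suc n) x - E x)" for n
    proof -
      have "complex_of_real ((nrm (e (Suc n)))\<^sup>2) = of_real (D (2 * Suc n))"
        unfolding L2_inner_self[symmetric] e_inner by (simp add: mult_2[symmetric])
      then have "(nrm (e (Suc n)))\<^sup>2 = D (2 * Suc n)"
        by (simp only: of_real_eq_iff)
      moreover have "\<Lambda>\<^sup>2 \<le> D m" for m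
        using N_lower[of "Suc m"] \<Lambda> by (simp add: D_def field_simps power2_eq_square)
      ultimately have "\<Lambda>\<^sup>2 \<le> (nrm (e (Suc n)))\<^sup>2"
        by simp
      then have "\<Lambda> \<le> nrm (e (Suc n))"
        by (rule power2_le_imp_le) simp
      also have "\<dots> \<le> nrm E + nrm (\<lambda>x. e (Suc n) x - E x)"
        using L2_norm_triangle[OF E L2_diff[OF e[of "Suc n"] E]] by simp
      finally show ?thesis .
    qed
    then show "\<exists>M. \<forall>n\<ge>M. \<Lambda> \<le> nrm E + nrm (\<lambda>x. e (Suc n) x - E x)"
      by blast
  qed

  \<comment> \<open>\<open>E\<close> is an eigenfunction for \<open>h \<star> h\<close>; as \<open>h\<close> is positive, \<open>(h + l) E\<close> is a nonzero one for \<open>h\<close>\<close>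
  define l where "l = sqrt \<Lambda>"
  have l: "l > 0" "l * l = \<Lambda>" "t < l"
  proof -
    show "l > 0" "l * l = \<Lambda>"
      using \<Lambda> by (simp_all add: l_def)
    have "s \<le> l"
      using s_\<Lambda> unfolding l_def by (rule real_le_rsqrt)
    with ts show "t < l" by simp
  qed
  define e' where "e' = (\<lambda>x. (E \<star> h) x + of_real l * E x)"
  have Eh: "E \<star> h \<in> L2" and lE: "(\<lambda>x. of_real l * E x) \<in> L2"
    by (intro conv_L2 L2_scale E h)+
  have e': "e' \<in> L2"
    unfolding e'_def by (intro L2_add Eh lE)
  have "e' \<star> h = (\<lambda>x. of_real l * e' x)"
  proof
    fix x
    have "(e' \<star> h) x = (E \<star> k) x + of_real l * (E \<star> h) x"
      unfolding e'_def conv_add_left[OF Eh lE h] conv_scale_left k_def by (simp add: conv_assoc E h)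
    also have "\<dots> = of_real l * e' x"
      unfolding E_eigen l(2)[symmetric] by (simp add: e'_def algebra_simps)
    finally show "(e' \<star> h) x = of_real l * e' x" .
  qed
  moreover have "nrm e' \<noteq> 0"
  proof
    assume "nrm e' = 0"
    then have "ip e' E = 0"
      using L2_inner_le[OF e' E] by simp
    moreover have "ip e' E = of_real ((nrm (E \<star> g))\<^sup>2 + l * (nrm E)\<^sup>2)"
      unfolding e'_def L2_inner_add_left[OF Eh lE E] L2_inner_scale_left
      unfolding h_def conv_square_inner[OF g E E] L2_inner_self by simp
    ultimately have "(nrm (E \<star> g))\<^sup>2 + l * (nrm E)\<^sup>2 = 0"
      by (simp only: of_real_eq_0_iff)
    moreover have "l * (nrm E)\<^sup>2 > 0"
      using l E_nz \<Lambda> by simp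
    ultimately show False
      using zero_le_power2[of "nrm (E \<star> g)"] by linarith
  qed
  ultimately show ?thesis
    using that[OF l(3) e'] by (simp add: h_def)
qed

end

section \<open>Irreducible subspaces and unitary representations\<close>

lemma mat_adjoint_index:
  assumes "A \<in> carrier_mat n n" "i < n" "j < n"
  shows "mat_adjoint A $$ (i, j) = cnj (A $$ (j, i))"
  using assms by (simp add: mat_adjoint_def mat_of_rows_index)

lemma mat_adjoint_carrier: "A \<in> carrier_mat n n \<Longrightarrow> mat_adjoint A \<in> carrier_mat n n"
  by (simp add: mat_adjoint_def mat_of_rows_def)

lemma mult_mat_index:
  assumes "A \<in> carrier_mat n n" "B \<in> carrier_mat n n" "i < n" "j < n"
  shows "(A * B) $$ (i, j) = (\<Sum>k<n. A $$ (i, k) * B $$ (k, j))"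
  using assms by (simp add: scalar_prod_def atLeast0LessThan)

lemma mult_mat_vec_index:
  assumes "A \<in> carrier_mat n n" "v \<in> carrier_vec n" "i < n"
  shows "vec_index (A *\<^sub>v v) i = (\<Sum>k<n. A $$ (i, k) * vec_index v k)"
  using assms by (simp add: scalar_prod_def atLeast0LessThan)

lemma
  assumes "v \<in> carrier_vec n"
  shows vec_norm_squared: "(vec_norm v)\<^sup>2 = (\<Sum>i<n. (cmod (vec_index v i))\<^sup>2)"
    and vec_norm_nonneg: "0 \<le> vec_norm v"
proof -
  have "v \<bullet>c v = of_real (\<Sum>i<n. (cmod (vec_index v i))\<^sup>2)"
    using assms by (simp add: scalar_prod_def atLeast0LessThan complex_norm_square[symmetric] del: of_real_power)
  then show "(vec_norm v)\<^sup>2 = (\<Sum>i<n. (cmod (vec_index v i))\<^sup>2)" "0 \<le> vec_norm v"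
    by (simp_all add: vec_norm_def sum_nonneg)
qed

lemma vec_norm_smult:
  assumes "v \<in> carrier_vec n"
  shows "vec_norm (c \<cdot>\<^sub>v v) = cmod c * vec_norm v"
proof (rule power2_eq_imp_eq)
  show "(vec_norm (c \<cdot>\<^sub>v v))\<^sup>2 = (cmod c * vec_norm v)\<^sup>2"
    using assms by (simp add: vec_norm_squared[of _ n] power_mult_distrib norm_mult sum_distrib_left)
qed (use assms in \<open>auto intro!: mult_nonneg_nonneg vec_norm_nonneg[of _ n]\<close>)

text \<open>
  The supremum that defines the operator norm is meaningful only for a bounded set, so the proof first bounds
  the image of the unit ball by the absolute row sums of the matrix.
\<close>

lemma vec_norm_mult_le_op_norm:
  assumes A: "A \<in> carrier_mat n n" and v: "v \<in> carrier_vec n"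
  shows "vec_norm (A *\<^sub>v v) \<le> mat_op_norm A * vec_norm v"
proof -
  let ?U = "{v \<in> carrier_vec (dim_col A). vec_norm v \<le> 1}"
  have dim: "dim_col A = n"
    using A by simp
  have Av: "A *\<^sub>v u \<in> carrier_vec n" for u
    using A by (intro carrier_vecI) simp
  have bdd: "bdd_above ((\<lambda>v. vec_norm (A *\<^sub>v v)) ` ?U)"
  proof (rule bdd_aboveI2)
    fix u assume "u \<in> ?U"
    then have u: "u \<in> carrier_vec n" "vec_norm u \<le> 1"
      using dim by auto
    have u1: "cmod (vec_index u k) \<le> 1" if "k < n" for k
    proof -
      have "(cmod (vec_index u k))\<^sup>2 \<le> (vec_norm u)\<^sup>2"
        unfolding vec_norm_squared[OF u(1)] using that by (intro member_le_sum) auto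
      also have "\<dots> \<le> 1"
        using u vec_norm_nonneg[OF u(1)] by (simp add: power_le_one)
      finally show ?thesis
        by (simp add: power_le_one_iff)
    qed
    have "(vec_norm (A *\<^sub>v u))\<^sup>2 \<le> (\<Sum>i<n. (\<Sum>k<n. cmod (A $$ (i, k)))\<^sup>2)"
      unfolding vec_norm_squared[OF Av]
    proof (intro sum_mono power_mono)
      fix i assume "i \<in> {..<n}"
      then have "cmod (vec_index (A *\<^sub>v u) i) \<le> (\<Sum>k<n. cmod (A $$ (i, k) * vec_index u k))"
        using mult_mat_vec_index[OF A u(1), of i] by (simp add: norm_sum)
      also have "\<dots> \<le> (\<Sum>k<n. cmod (A $$ (i, k)))"
        using u1 by (intro sum_mono) (simp add: norm_mult mult_left_le)
      finally show "cmod (vec_index (A *\<^sub>v u) i) \<le> (\<Sum>k<n. cmod (A $$ (i, k)))" .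
    qed simp
    then show "vec_norm (A *\<^sub>v u) \<le> sqrt (\<Sum>i<n. (\<Sum>k<n. cmod (A $$ (i, k)))\<^sup>2)"
      by (rule real_le_rsqrt)
  qed
  have upper: "vec_norm (A *\<^sub>v u) \<le> mat_op_norm A" if "u \<in> carrier_vec n" "vec_norm u \<le> 1" for u
    unfolding mat_op_norm_def using that dim by (intro cSUP_upper bdd) auto
  show ?thesis
  proof (cases "vec_norm v = 0")
    case True
    then have "(\<Sum>i<n. (cmod (vec_index v i))\<^sup>2) = 0"
      using vec_norm_squared[OF v] by simp
    then have "vec_index v k = 0" if "k < n" for k
      using that by (simp add: sum_nonneg_eq_0_iff)
    then have "(vec_norm (A *\<^sub>v v))\<^sup>2 = 0"
      by (simp add: vec_norm_squared[OF Av] mult_mat_vec_index[OF A v] del: index_mult_mat_vec)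
    then show ?thesis
      using True by simp
  next
    case False
    then have pos: "vec_norm v > 0"
      using vec_norm_nonneg[OF v] by simp
    let ?c = "complex_of_real (1 / vec_norm v)"
    have "vec_norm (A *\<^sub>v (?c \<cdot>\<^sub>v v)) \<le> mat_op_norm A"
      using v pos by (intro upper) (simp_all add: vec_norm_smult norm_divide)
    moreover have "A *\<^sub>v (?c \<cdot>\<^sub>v v) = ?c \<cdot>\<^sub>v (A *\<^sub>v v)"
      using A v by (rule mult_mat_vec)
    moreover have "vec_norm (?c \<cdot>\<^sub>v (A *\<^sub>v v)) = 1 / vec_norm v * vec_norm (A *\<^sub>v v)"
      unfolding vec_norm_smult[OF Av] using pos by (simp add: norm_divide)
    ultimately have "1 / vec_norm v * vec_norm (A *\<^sub>v v) \<le> mat_op_norm A"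
      by (simp only:)
    then show ?thesis
      using pos by (simp add: pos_divide_le_eq)
  qed
qed

context compact_metric_group
begin

definition invariant_subspace :: "('a \<Rightarrow> complex) set \<Rightarrow> bool" where
  "invariant_subspace S \<longleftrightarrow> S \<subseteq> L2 \<and> (\<lambda>x. 0) \<in> S \<and>
     (\<forall>u\<in>S. \<forall>v\<in>S. (\<lambda>x. u x + v x) \<in> S) \<and> (\<forall>c. \<forall>u\<in>S. (\<lambda>x. c * u x) \<in> S) \<and>
     (\<forall>a. \<forall>u\<in>S. translate a u \<in> S)"

text \<open>
  The elements of an invariant subspace are functions, not classes modulo null sets. Identities between them
  hold pointwise if no nonzero element has norm \<open>0\<close>, as is the case for an eigenspace with a nonzero eigenvalue.
\<close>

definition definite :: "('a \<Rightarrow> complex) set \<Rightarrow> bool" where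
  "definite S \<longleftrightarrow> (\<forall>u\<in>S. nrm u = 0 \<longrightarrow> u = (\<lambda>x. 0))"

text \<open>
  Stated with the norm, so that an element can be normalised.
\<close>

definition nontrivial :: "('a \<Rightarrow> complex) set \<Rightarrow> bool" where
  "nontrivial S \<longleftrightarrow> (\<exists>u\<in>S. nrm u \<noteq> 0)"

definition has_orthonormal :: "('a \<Rightarrow> complex) set \<Rightarrow> nat \<Rightarrow> bool" where
  "has_orthonormal S n \<longleftrightarrow> (\<exists>w. orthonormal \<mu> n w \<and> (\<forall>i<n. w i \<in> S))"

definition orthonormal_basis :: "('a \<Rightarrow> complex) set \<Rightarrow> nat \<Rightarrow> (nat \<Rightarrow> 'a \<Rightarrow> complex) \<Rightarrow> bool" where
  "orthonormal_basis S n w \<longleftrightarrow> orthonormal \<mu> n w \<and> (\<forall>i<n. w i \<in> S) \<and>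
     (\<forall>u\<in>S. u = projection \<mu> n w u)"

definition irreducible_subspace :: "('a \<Rightarrow> complex) set \<Rightarrow> bool" where
  "irreducible_subspace S \<longleftrightarrow> invariant_subspace S \<and> nontrivial S \<and>
     (\<forall>U. invariant_subspace U \<and> nontrivial U \<and> U \<subseteq> S \<longrightarrow> U = S)"

lemma
  assumes "invariant_subspace S"
  shows invariant_subspace_L2: "u \<in> S \<Longrightarrow> u \<in> L2"
    and invariant_subspace_add: "u \<in> S \<Longrightarrow> v \<in> S \<Longrightarrow> (\<lambda>x. u x + v x) \<in> S"
    and invariant_subspace_scale: "u \<in> S \<Longrightarrow> (\<lambda>x. c * u x) \<in> S"
    and invariant_subspace_translate: "u \<in> S \<Longrightarrow> translate a u \<in> S"
    and invariant_subspace_zero: "(\<lambda>x. 0) \<in> S"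
  using assms by (auto simp: invariant_subspace_def)

lemma invariant_subspace_sum:
  assumes S: "invariant_subspace S"
  shows "(\<And>i. i \<in> I \<Longrightarrow> u i \<in> S) \<Longrightarrow> (\<lambda>x. \<Sum>i\<in>I. u i x) \<in> S"
  by (induction I rule: infinite_finite_induct)
    (simp_all add: invariant_subspace_zero[OF S] invariant_subspace_add[OF S])

lemma invariant_subspace_comb:
  assumes "invariant_subspace S" "\<And>i. i < n \<Longrightarrow> w i \<in> S"
  shows "(\<lambda>x. \<Sum>i<n. c i * w i x) \<in> S"
  using assms by (intro invariant_subspace_sum invariant_subspace_scale) auto

lemma invariant_subspace_projection:
  assumes "invariant_subspace S" "\<And>i. i < n \<Longrightarrow> w i \<in> S"
  shows "projection \<mu> n w u \<in> S"
  using invariant_subspace_comb[OF assms] by (simp add: projection_def[abs_def])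

lemma ip_normalized:
  assumes "nrm u \<noteq> 0"
  shows "ip (\<lambda>x. complex_of_real (1 / nrm u) * u x) (\<lambda>x. complex_of_real (1 / nrm u) * u x) = 1"
  unfolding L2_inner_scale_left L2_inner_scale_right L2_inner_self
  using assms by (simp add: power2_eq_square)

lemma maximal_orthonormal_is_basis:
  assumes S: "invariant_subspace S" and dfn: "definite S" and w: "orthonormal \<mu> n w"
    and wS: "\<And>i. i < n \<Longrightarrow> w i \<in> S" and max: "\<not> has_orthonormal S (Suc n)"
  shows "orthonormal_basis S n w"
proof -
  have "u = projection \<mu> n w u" if u: "u \<in> S" for u
  proof -
    define r where "r = (\<lambda>x. u x - projection \<mu> n w u x)"
    have u2: "u \<in> L2"
      using S u by (rule invariant_subspace_L2)
    have "(\<lambda>x. u x + - 1 * projection \<mu> n w u x) \<in> S"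
      by (intro invariant_subspace_add[OF S] invariant_subspace_scale[OF S] u
          invariant_subspace_projection[OF S] wS)
    then have rS: "r \<in> S"
      by (simp add: r_def)
    then have r2: "r \<in> L2"
      by (rule invariant_subspace_L2[OF S])
    have orth: "ip r (w j) = 0" if "j < n" for j
      unfolding r_def using w u2 that by (rule projection_residue_orthogonal(1))
    have "nrm r = 0"
    proof (rule ccontr)
      assume nz: "nrm r \<noteq> 0"
      define c where "c = complex_of_real (1 / nrm r)"
      define v where "v = (\<lambda>x. c * r x)"
      have vS: "v \<in> S"
        unfolding v_def using S rS by (rule invariant_subspace_scale)
      then have v2: "v \<in> L2"
        by (rule invariant_subspace_L2[OF S])
      have vv: "ip v v = 1"
        unfolding v_def c_def using nz by (rule ip_normalized)
      have vw: "ip v (w j) = 0" if "j < n" for j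
        using orth[OF that] by (simp add: v_def L2_inner_scale_left)
      have wv: "ip (w j) v = 0" if "j < n" for j
        using vw[OF that] by (subst L2_inner_commute) simp
      have "orthonormal \<mu> (Suc n) (w(n := v))"
        using w v2 vv vw wv by (auto simp: orthonormal_def less_Suc_eq)
      moreover have "\<forall>i<Suc n. (w(n := v)) i \<in> S"
        using wS vS by (auto simp: less_Suc_eq)
      ultimately show False
        using max by (auto simp: has_orthonormal_def)
    qed
    then have "r = (\<lambda>x. 0)"
      using dfn rS by (simp add: definite_def)
    then show ?thesis
      by (simp add: r_def fun_eq_iff)
  qed
  then show ?thesis
    using w wS by (simp add: orthonormal_basis_def)
qed

lemma has_orthonormal_one:
  assumes S: "invariant_subspace S" and nt: "nontrivial S"
  shows "has_orthonormal S 1"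
proof -
  from nt obtain u where u: "u \<in> S" "nrm u \<noteq> 0"
    by (auto simp: nontrivial_def)
  define v where "v = (\<lambda>x. complex_of_real (1 / nrm u) * u x)"
  have "v \<in> S"
    unfolding v_def using S u(1) by (rule invariant_subspace_scale)
  moreover have "ip v v = 1"
    unfolding v_def using u(2) by (rule ip_normalized)
  ultimately have "orthonormal \<mu> 1 (\<lambda>i. v)"
    using invariant_subspace_L2[OF S] by (simp add: orthonormal_def)
  then show ?thesis
    using \<open>v \<in> S\<close> by (auto simp: has_orthonormal_def)
qed

text \<open>
  Among the nontrivial invariant subspaces choose one, \<open>S\<close>, of minimal dimension \<open>n\<close>; dimension is expressed
  by the largest orthonormal family. A nontrivial invariant subspace of \<open>S\<close> contains \<open>n\<close> orthonormal
  elements as well, and these already span \<open>S\<close>.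
\<close>

lemma irreducible_subspace_exists:
  assumes V: "invariant_subspace V" "nontrivial V" "definite V" and bound: "\<not> has_orthonormal V (Suc m)"
  obtains S n w where "irreducible_subspace S" "S \<subseteq> V" "n > 0" "orthonormal_basis S n w"
proof -
  define Q where "Q n \<longleftrightarrow> (\<exists>S. invariant_subspace S \<and> nontrivial S \<and> S \<subseteq> V \<and> \<not> has_orthonormal S (Suc n))" for n
  define n where "n = (LEAST n. Q n)"
  have "Q m"
    using V bound by (auto simp: Q_def)
  then have "Q n"
    unfolding n_def by (rule LeastI)
  then obtain S where S: "invariant_subspace S" "nontrivial S" "S \<subseteq> V" "\<not> has_orthonormal S (Suc n)"
    by (auto simp: Q_def)
  have least: "has_orthonormal U n" if "invariant_subspace U" "nontrivial U" "U \<subseteq> V" for U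
  proof (cases n)
    case 0
    then show ?thesis
      by (simp add: has_orthonormal_def orthonormal_def)
  next
    case (Suc k)
    then have "\<not> Q k"
      using not_less_Least[of k Q] by (simp add: n_def)
    with that Suc show ?thesis
      by (auto simp: Q_def)
  qed
  have basis: "\<exists>w. orthonormal_basis S n w \<and> (\<forall>i<n. w i \<in> U)"
    if U: "invariant_subspace U" "nontrivial U" "U \<subseteq> S" for U
  proof -
    have "has_orthonormal U n"
      using U S(3) by (intro least) auto
    then obtain w where w: "orthonormal \<mu> n w" "\<And>i. i < n \<Longrightarrow> w i \<in> U"
      by (auto simp: has_orthonormal_def)
    have "definite S"
      using V(3) S(3) by (auto simp: definite_def)
    then have "orthonormal_basis S n w"
      using S(1,4) w U(3) by (intro maximal_orthonormal_is_basis) auto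
    with w show ?thesis by blast
  qed
  have "U = S" if U: "invariant_subspace U" "nontrivial U" "U \<subseteq> S" for U
  proof -
    from basis[OF U] obtain w where w: "orthonormal_basis S n w" "\<And>i. i < n \<Longrightarrow> w i \<in> U"
      by blast
    have "u \<in> U" if "u \<in> S" for u
    proof -
      have "u = projection \<mu> n w u"
        using w(1) that by (simp add: orthonormal_basis_def)
      moreover have "projection \<mu> n w u \<in> U"
        by (rule invariant_subspace_projection[OF U(1) w(2)])
      ultimately show ?thesis by simp
    qed
    with U(3) show ?thesis by blast
  qed
  then have "irreducible_subspace S"
    using S by (auto simp: irreducible_subspace_def)
  moreover obtain w where "orthonormal_basis S n w"
    using basis[OF S(1,2)] by blast
  moreover have "n > 0"
    using has_orthonormal_one[OF S(1,2)] S(4) by (cases n) simp_all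
  ultimately show ?thesis
    using that S(3) by blast
qed

definition matrix_coefficients :: "nat \<Rightarrow> (nat \<Rightarrow> 'a \<Rightarrow> complex) \<Rightarrow> 'a \<Rightarrow> complex mat" where
  "matrix_coefficients n w a = mat n n (\<lambda>(i, j). ip (translate a (w j)) (w i))"

lemma matrix_coefficients_carrier: "matrix_coefficients n w a \<in> carrier_mat n n"
  by (simp add: matrix_coefficients_def)

lemma matrix_coefficients_index:
  "i < n \<Longrightarrow> j < n \<Longrightarrow> matrix_coefficients n w a $$ (i, j) = ip (translate a (w j)) (w i)"
  by (simp add: matrix_coefficients_def)

lemma translate_basis:
  assumes S: "invariant_subspace S" and w: "orthonormal_basis S n w" and j: "j < n"
  shows "translate a (w j) = (\<lambda>x. \<Sum>i<n. matrix_coefficients n w a $$ (i, j) * w i x)"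
proof -
  have "translate a (w j) \<in> S"
    using w j by (intro invariant_subspace_translate[OF S]) (simp add: orthonormal_basis_def)
  then have "translate a (w j) = projection \<mu> n w (translate a (w j))"
    using w by (simp add: orthonormal_basis_def)
  then show ?thesis
    using j by (simp add: projection_def[abs_def] matrix_coefficients_index)
qed

lemma translate_comb:
  assumes S: "invariant_subspace S" and w: "orthonormal_basis S n w" and v: "v \<in> carrier_vec n"
  shows "translate a (\<lambda>x. \<Sum>j<n. vec_index v j * w j x)
    = (\<lambda>x. \<Sum>i<n. vec_index (matrix_coefficients n w a *\<^sub>v v) i * w i x)"
proof
  fix x
  have "translate a (\<lambda>x. \<Sum>j<n. vec_index v j * w j x) x = (\<Sum>j<n. vec_index v j * translate a (w j) x)"
    by (simp add: translate_def)
  also have "\<dots> = (\<Sum>j<n. \<Sum>i<n. vec_index v j * (matrix_coefficients n w a $$ (i, j) * w i x))"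
    by (simp add: translate_basis[OF S w] sum_distrib_left)
  also have "\<dots> = (\<Sum>i<n. \<Sum>j<n. vec_index v j * (matrix_coefficients n w a $$ (i, j) * w i x))"
    by (rule sum.swap)
  also have "\<dots> = (\<Sum>i<n. vec_index (matrix_coefficients n w a *\<^sub>v v) i * w i x)"
    by (intro sum.cong refl)
      (simp add: mult_mat_vec_index[OF matrix_coefficients_carrier v] sum_distrib_left sum_distrib_right mult_ac
        del: index_mult_mat_vec)
  finally show "translate a (\<lambda>x. \<Sum>j<n. vec_index v j * w j x) x
    = (\<Sum>i<n. vec_index (matrix_coefficients n w a *\<^sub>v v) i * w i x)" .
qed

text \<open>
  The columns are orthonormal because translation preserves the inner product, and the entries are continuous because
  they are conjugates of convolutions of basis functions.
\<close>

lemma unitary_matrix_coefficients: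
  assumes S: "invariant_subspace S" and w: "orthonormal_basis S n w"
  shows "unitary_rep n (matrix_coefficients n w)"
proof -
  let ?\<pi> = "matrix_coefficients n w"
  have on: "orthonormal \<mu> n w"
    using w by (simp add: orthonormal_basis_def)
  note w2 = orthonormal_L2[OF on]
  note car = matrix_coefficients_carrier
  have "mat_adjoint (?\<pi> a) * ?\<pi> a = 1\<^sub>m n" for a
  proof (rule eq_matI)
    fix i j assume "i < dim_row (1\<^sub>m n :: complex mat)" "j < dim_col (1\<^sub>m n :: complex mat)"
    then have ij: "i < n" "j < n" by simp_all
    have "(mat_adjoint (?\<pi> a) * ?\<pi> a) $$ (i, j) = (\<Sum>k<n. ?\<pi> a $$ (k, j) * cnj (?\<pi> a $$ (k, i)))"
      using ij by (simp add: mult_mat_index[OF mat_adjoint_carrier[OF car] car]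
          mat_adjoint_index[OF car] mult.commute del: index_mult_mat)
    also have "\<dots> = ip (translate a (w j)) (translate a (w i))"
      unfolding translate_basis[OF S w ij(1)] translate_basis[OF S w ij(2)]
      by (rule orthonormal_comb_inner_comb[OF on, symmetric])
    also have "\<dots> = 1\<^sub>m n $$ (i, j)"
      using ij on by (simp add: ip_translate w2 orthonormal_inner)
    finally show "(mat_adjoint (?\<pi> a) * ?\<pi> a) $$ (i, j) = 1\<^sub>m n $$ (i, j)" .
  qed (use car[of n w a] mat_adjoint_carrier[OF car, of n w a] in auto)
  moreover have "?\<pi> 0 = 1\<^sub>m n"
    using on by (intro eq_matI) (auto simp: matrix_coefficients_def orthonormal_inner)
  moreover have "?\<pi> (a + b) = ?\<pi> a * ?\<pi> b" for a b
  proof (rule eq_matI)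
    fix i j assume "i < dim_row (?\<pi> a * ?\<pi> b)" "j < dim_col (?\<pi> a * ?\<pi> b)"
    then have ij: "i < n" "j < n"
      by (simp_all add: matrix_coefficients_def)
    have "translate (a + b) (w j) = translate a (\<lambda>x. \<Sum>k<n. ?\<pi> b $$ (k, j) * w k x)"
      unfolding translate_basis[OF S w ij(2), symmetric] by (rule translate_translate[symmetric])
    also have "\<dots> = (\<lambda>x. \<Sum>k<n. ?\<pi> b $$ (k, j) * translate a (w k) x)"
      by (simp add: translate_def)
    finally have eq: "translate (a + b) (w j) = (\<lambda>x. \<Sum>k<n. ?\<pi> b $$ (k, j) * translate a (w k) x)" .
    have "ip (translate (a + b) (w j)) (w i) = (\<Sum>k<n. ?\<pi> b $$ (k, j) * ip (translate a (w k)) (w i))"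
      unfolding eq using ij
      by (subst L2_inner_sum_left) (auto simp: L2_inner_scale_left intro!: L2_scale translate_L2 w2)
    then show "?\<pi> (a + b) $$ (i, j) = (?\<pi> a * ?\<pi> b) $$ (i, j)"
      using ij by (simp add: mult_mat_index[OF car car] matrix_coefficients_index mult.commute del: index_mult_mat)
  qed (simp_all add: matrix_coefficients_def)
  moreover have "continuous_on UNIV (\<lambda>a. ?\<pi> a $$ (i, j))" if ij: "i < n" "j < n" for i j
  proof -
    have "?\<pi> a $$ (i, j) = cnj ((w i \<star> invol (w j)) a)" for a
      using ij by (simp add: matrix_coefficients_index ip_translate_eq_conv[symmetric] L2_inner_commute[symmetric])
    moreover have "continuous_on UNIV (\<lambda>a. cnj ((w i \<star> invol (w j)) a))"
      using conv_continuous[OF w2[OF ij(1)] invol_L2[OF w2[OF ij(2)]]] by (intro continuous_intros)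
    ultimately show ?thesis by simp
  qed
  ultimately show ?thesis
    by (simp add: unitary_rep_def car)
qed

text \<open>
  Taking linear combinations of the basis carries a space of coefficient vectors that is stable under all the matrices to a
  translation-invariant subspace of \<open>S\<close>.
\<close>

lemma irreducible_matrix_coefficients:
  assumes irr: "irreducible_subspace S" and w: "orthonormal_basis S n w" and n: "n > 0"
  shows "irreducible_rep n (matrix_coefficients n w)"
  unfolding irreducible_rep_def
proof (intro conjI allI impI n)
  fix W assume asm: "VectorSpace.subspace class_ring W (module_vec TYPE(complex) n) \<and>
    (\<forall>x. \<forall>v\<in>W. matrix_coefficients n w x *\<^sub>v v \<in> W)"
  have S: "invariant_subspace S"
    using irr by (simp add: irreducible_subspace_def)
  have on: "orthonormal \<mu> n w" and wS: "\<And>i. i < n \<Longrightarrow> w i \<in> S"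
    using w by (simp_all add: orthonormal_basis_def)
  have "submodule class_ring W (module_vec TYPE(complex) n)"
    using asm by (simp add: subspace_def)
  then have Wc: "W \<subseteq> carrier_vec n" and W_add: "\<And>u v. u \<in> W \<Longrightarrow> v \<in> W \<Longrightarrow> u + v \<in> W"
    and W_0: "0\<^sub>v n \<in> W" and W_smult: "\<And>c v. v \<in> W \<Longrightarrow> c \<cdot>\<^sub>v v \<in> W"
    by (auto simp: submodule_def module_vec_simps)
  have Wd: "dim_vec v = n" if "v \<in> W" for v
    using Wc that by auto
  define comb where "comb v = (\<lambda>x. \<Sum>i<n. vec_index v i * w i x)" for v
  define U where "U = comb ` W"
  have comb_S: "comb v \<in> S" for v
    unfolding comb_def by (rule invariant_subspace_comb[OF S wS])
  have comb_inj: "u = v" if "comb u = comb v" "u \<in> carrier_vec n" "v \<in> carrier_vec n" for u v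
  proof (rule eq_vecI)
    fix i assume "i < dim_vec v"
    then have i: "i < n" using that by simp
    show "vec_index u i = vec_index v i"
      using orthonormal_comb_inner[OF on i, of "vec_index u"] orthonormal_comb_inner[OF on i, of "vec_index v"]
        that(1) by (simp add: comb_def)
  qed (use that in simp)
  have "invariant_subspace U"
    unfolding invariant_subspace_def
  proof (intro conjI ballI allI)
    show "U \<subseteq> L2"
      using comb_S invariant_subspace_L2[OF S] by (auto simp: U_def)
    have "comb (0\<^sub>v n) = (\<lambda>x. 0)"
      by (simp add: comb_def)
    with W_0 show "(\<lambda>x. 0) \<in> U"
      unfolding U_def by (metis image_eqI)
  next
    fix u v assume "u \<in> U" "v \<in> U"
    then obtain u' v' where uv: "u' \<in> W" "v' \<in> W" "u = comb u'" "v = comb v'"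
      by (auto simp: U_def)
    then have "(\<lambda>x. u x + v x) = comb (u' + v')"
      by (simp add: comb_def Wd sum.distrib distrib_right)
    with W_add[OF uv(1,2)] show "(\<lambda>x. u x + v x) \<in> U"
      unfolding U_def by (metis image_eqI)
  next
    fix c u assume "u \<in> U"
    then obtain u' where u: "u' \<in> W" "u = comb u'"
      by (auto simp: U_def)
    then have "(\<lambda>x. c * u x) = comb (c \<cdot>\<^sub>v u')"
      by (simp add: comb_def Wd sum_distrib_left mult.assoc)
    with W_smult[OF u(1)] show "(\<lambda>x. c * u x) \<in> U"
      unfolding U_def by (metis image_eqI)
  next
    fix a u assume "u \<in> U"
    then obtain u' where u: "u' \<in> W" "u = comb u'"
      by (auto simp: U_def)
    then have "translate a u = comb (matrix_coefficients n w a *\<^sub>v u')"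
      using translate_comb[OF S w, of u' a] Wc by (auto simp: comb_def)
    with asm u(1) show "translate a u \<in> U"
      unfolding U_def by (metis image_eqI)
  qed
  moreover have "U \<subseteq> S"
    using comb_S by (auto simp: U_def)
  ultimately have alt: "nontrivial U \<Longrightarrow> U = S"
    using irr by (simp add: irreducible_subspace_def)
  show "W = {0\<^sub>v n} \<or> W = carrier_vec n"
  proof (cases "W = {0\<^sub>v n}")
    case False
    with W_0 obtain v where v: "v \<in> W" "v \<noteq> 0\<^sub>v n" by blast
    have "nrm (comb v) \<noteq> 0"
    proof
      assume "nrm (comb v) = 0"
      then have "(\<Sum>i<n. (cmod (vec_index v i))\<^sup>2) = 0"
        using orthonormal_comb_norm[OF on, of "vec_index v"] by (simp add: comb_def)
      then have "\<forall>i<n. vec_index v i = 0"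
        by (simp add: sum_nonneg_eq_0_iff)
      then have "v = 0\<^sub>v n"
        using Wd[OF v(1)] by (intro eq_vecI) auto
      with v show False by simp
    qed
    with v(1) have "nontrivial U"
      by (auto simp: nontrivial_def U_def)
    then have US: "U = S" by (rule alt)
    have "u \<in> W" if u: "u \<in> carrier_vec n" for u
    proof -
      have "comb u \<in> comb ` W"
        using comb_S[of u] US by (simp add: U_def)
      then obtain u' where "u' \<in> W" "comb u = comb u'" by auto
      then show ?thesis
        using comb_inj[of u u'] u Wc by auto
    qed
    with Wc show ?thesis by blast
  qed simp
qed

text \<open>
  The norm of \<open>u\<close> is the Euclidean norm of its coefficient vector, so local randomness of the representation on
  \<open>S\<close> bounds the displacement of \<open>u\<close> itself.
\<close>

lemma translate_close_on_irreducible: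
  assumes lr: "locally_random TYPE('a) L C" and irr: "irreducible_subspace S"
    and w: "orthonormal_basis S n w" and n: "n > 0" and u: "u \<in> S"
  shows "nrm (\<lambda>x. translate a u x - u x) \<le> C * real n powr L * dist a 0 * nrm u"
proof -
  let ?\<pi> = "matrix_coefficients n w"
  have S: "invariant_subspace S"
    using irr by (simp add: irreducible_subspace_def)
  have on: "orthonormal \<mu> n w"
    using w by (simp add: orthonormal_basis_def)
  have rep: "unitary_rep n ?\<pi>" "irreducible_rep n ?\<pi>"
    using unitary_matrix_coefficients[OF S w] irreducible_matrix_coefficients[OF irr w n] by simp_all
  define v where "v = vec n (\<lambda>i. ip u (w i))"
  have v: "v \<in> carrier_vec n"
    by (simp add: v_def)
  have u_eq: "u = (\<lambda>x. \<Sum>i<n. vec_index v i * w i x)"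
  proof -
    have "u = projection \<mu> n w u"
      using w u by (simp add: orthonormal_basis_def)
    then show ?thesis
      by (simp add: projection_def[abs_def] v_def)
  qed
  have nrm_comb: "nrm (\<lambda>x. \<Sum>i<n. vec_index z i * w i x) = vec_norm z" if "z \<in> carrier_vec n" for z
    using orthonormal_comb_norm[OF on, of "vec_index z"] vec_norm_squared[OF that] vec_norm_nonneg[OF that]
    by - (rule power2_eq_imp_eq, simp_all)
  let ?A = "?\<pi> a - ?\<pi> 0"
  have A: "?A \<in> carrier_mat n n"
    by (intro minus_carrier_mat matrix_coefficients_carrier)
  have \<pi>0: "?\<pi> 0 *\<^sub>v v = v"
    using rep(1) v by (simp add: unitary_rep_def)
  have Av: "?A *\<^sub>v v = ?\<pi> a *\<^sub>v v - v"
    using minus_mult_distrib_mat_vec[OF matrix_coefficients_carrier matrix_coefficients_carrier v] \<pi>0 by simp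
  have "(\<lambda>x. translate a u x - u x) = (\<lambda>x. \<Sum>i<n. vec_index (?A *\<^sub>v v) i * w i x)"
  proof
    fix x
    have "translate a u x = (\<Sum>i<n. vec_index (?\<pi> a *\<^sub>v v) i * w i x)"
      using translate_comb[OF S w v, of a] u_eq by simp
    moreover have "u x = (\<Sum>i<n. vec_index v i * w i x)"
      by (subst u_eq) simp
    moreover have "vec_index (?A *\<^sub>v v) i = vec_index (?\<pi> a *\<^sub>v v) i - vec_index v i" if "i < n" for i
      unfolding Av using that v by simp
    ultimately show "translate a u x - u x = (\<Sum>i<n. vec_index (?A *\<^sub>v v) i * w i x)"
      by (simp add: sum_subtractf left_diff_distrib del: index_mult_mat_vec)
  qed
  then have "nrm (\<lambda>x. translate a u x - u x) = vec_norm (?A *\<^sub>v v)"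
    using A v by (simp add: nrm_comb)
  also have "\<dots> \<le> mat_op_norm ?A * vec_norm v"
    by (rule vec_norm_mult_le_op_norm[OF A v])
  also have "\<dots> \<le> (C * real n powr L * dist a 0) * vec_norm v"
    using lr rep by (intro mult_right_mono vec_norm_nonneg[OF v]) (auto simp: locally_random_def)
  also have "vec_norm v = nrm u"
    using nrm_comb[OF v] u_eq by simp
  finally show ?thesis .
qed

section \<open>Splitting off irreducible subspaces\<close>

definition eigenspace :: "('a \<Rightarrow> complex) \<Rightarrow> real \<Rightarrow> ('a \<Rightarrow> complex) set" where
  "eigenspace h l = {v \<in> L2. v \<star> h = (\<lambda>x. of_real l * v x)}"

lemma invariant_subspace_eigenspace:
  assumes h: "h \<in> L2"
  shows "invariant_subspace (eigenspace h l)"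
  unfolding invariant_subspace_def
proof (intro conjI ballI allI)
  show "eigenspace h l \<subseteq> L2"
    by (auto simp: eigenspace_def)
  show "(\<lambda>x. 0) \<in> eigenspace h l"
    by (simp add: eigenspace_def L2_zero fun_eq_iff conv_eq_ip)
next
  fix u v assume "u \<in> eigenspace h l" "v \<in> eigenspace h l"
  then show "(\<lambda>x. u x + v x) \<in> eigenspace h l"
    using h by (simp add: eigenspace_def L2_add conv_add_left distrib_left)
next
  fix c u assume "u \<in> eigenspace h l"
  then show "(\<lambda>x. c * u x) \<in> eigenspace h l"
    by (simp add: eigenspace_def L2_scale conv_scale_left mult.left_commute)
next
  fix a u assume "u \<in> eigenspace h l"
  then show "translate a u \<in> eigenspace h l"
    using h by (simp add: eigenspace_def translate_L2 conv_translate[symmetric]) (simp add: translate_def)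
qed

lemma definite_eigenspace:
  assumes h: "h \<in> L2" and l: "l \<noteq> 0"
  shows "definite (eigenspace h l)"
  unfolding definite_def
proof (intro ballI impI ext)
  fix v x assume v: "v \<in> eigenspace h l" and "nrm v = 0"
  then have "cmod ((v \<star> h) x) \<le> 0"
    using conv_bound[of v h x] h by (simp add: eigenspace_def)
  then show "v x = 0"
    using v l by (simp add: eigenspace_def)
qed

text \<open>
  \<open>\<parallel>g\<parallel>\<^sup>2\<close> is the squared Hilbert-Schmidt norm of \<open>u \<mapsto> u \<star> g\<close>: at each point \<open>x\<close> the values of \<open>w i \<star> g\<close> are
  coefficients of a translate of \<open>invol g\<close>, and Bessel's inequality applies.
\<close>

lemma sum_nrm_conv_le:
  assumes w: "orthonormal \<mu> n w" and g: "g \<in> L2"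
  shows "(\<Sum>i<n. (nrm (w i \<star> g))\<^sup>2) \<le> (nrm g)\<^sup>2"
proof -
  have int: "integrable \<mu> (\<lambda>x. (cmod ((w i \<star> g) x))\<^sup>2)" if "i < n" for i
    using that w g by (intro L2_square_integrable conv_L2) (auto simp: orthonormal_L2)
  have pt: "(\<Sum>i<n. (cmod ((w i \<star> g) x))\<^sup>2) \<le> (nrm g)\<^sup>2" for x
  proof -
    have "cmod ((w i \<star> g) x) = cmod (ip (translate x (invol g)) (w i))" for i
      by (subst L2_inner_commute) (simp add: conv_eq_ip)
    then show ?thesis
      using bessel[OF w translate_L2[OF invol_L2[OF g]], of x] by (simp add: nrm_translate nrm_invol invol_L2 g)
  qed
  have "(\<Sum>i<n. (nrm (w i \<star> g))\<^sup>2) = (LINT x|\<mu>. (\<Sum>i<n. (cmod ((w i \<star> g) x))\<^sup>2))"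
    unfolding L2_norm_squared using int by (subst Bochner_Integration.integral_sum) auto
  also have "\<dots> \<le> (LINT x|\<mu>. (nrm g)\<^sup>2)"
    using int pt by (intro integral_mono Bochner_Integration.integrable_sum) auto
  finally show ?thesis by simp
qed

lemma eigenspace_conv_norm:
  assumes g: "g \<in> L2" and u: "u \<in> eigenspace (g \<star> invol g) l"
  shows "(nrm (u \<star> g))\<^sup>2 = l * (nrm u)\<^sup>2"
proof -
  have u2: "u \<in> L2"
    using u by (simp add: eigenspace_def)
  have "complex_of_real ((nrm (u \<star> g))\<^sup>2) = ip (\<lambda>x. of_real l * u x) u"
    unfolding L2_inner_self[symmetric] conv_square_inner[OF g u2 u2, symmetric]
    using u by (simp add: eigenspace_def)
  also have "\<dots> = of_real (l * (nrm u)\<^sup>2)"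
    unfolding L2_inner_scale_left L2_inner_self by simp
  finally show ?thesis
    by (simp only: of_real_eq_iff)
qed

text \<open>
  Each normalised eigenfunction takes the share \<open>l\<close> of the squared Hilbert-Schmidt norm. So eigenspaces of positive
  eigenvalues have finite dimension, and large eigenvalues occur only in small dimension.
\<close>

lemma eigenspace_dimension_bound:
  assumes g: "g \<in> L2" and n: "has_orthonormal (eigenspace (g \<star> invol g) l) n"
  shows "real n * l \<le> (nrm g)\<^sup>2"
proof -
  from n obtain w where w: "orthonormal \<mu> n w" "\<And>i. i < n \<Longrightarrow> w i \<in> eigenspace (g \<star> invol g) l"
    by (auto simp: has_orthonormal_def)
  have "(nrm (w i \<star> g))\<^sup>2 = l" if "i < n" for i
  proof -
    have "complex_of_real ((nrm (w i))\<^sup>2) = 1"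
      unfolding L2_inner_self[symmetric] using orthonormal_inner[OF w(1) that that] by simp
    then have "(nrm (w i))\<^sup>2 = 1"
      by (simp only: of_real_eq_1_iff)
    then show ?thesis
      using eigenspace_conv_norm[OF g w(2)[OF that]] by simp
  qed
  then show ?thesis
    using sum_nrm_conv_le[OF w(1) g] by simp
qed

text \<open>
  If the span of the \<open>w j\<close> is translation-invariant, then the shifts of this function form the kernel of the
  orthogonal projection onto it.
\<close>

definition reproducing_kernel :: "nat \<Rightarrow> (nat \<Rightarrow> 'a \<Rightarrow> complex) \<Rightarrow> 'a \<Rightarrow> complex" where
  "reproducing_kernel n w x = (\<Sum>j<n. cnj (w j 0) * w j x)"

text \<open>
  The kernel of the projection onto an invariant space is unchanged when both arguments are translated. In terms of
  matrices, the representation is unitary, so \<open>w i y\<close> is expressed through the values \<open>w j 0\<close> with the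
  conjugates of the entries that express \<open>w j (- y + x)\<close> through the \<open>w i x\<close>.
\<close>

lemma reproducing_kernel_shift:
  assumes S: "invariant_subspace S" and w: "orthonormal_basis S n w"
  shows "reproducing_kernel n w (- y + x) = (\<Sum>i<n. cnj (w i y) * w i x)"
proof -
  let ?\<pi> = "matrix_coefficients n w"
  have on: "orthonormal \<mu> n w"
    using w by (simp add: orthonormal_basis_def)
  have inv: "?\<pi> (- y) $$ (j, i) = cnj (?\<pi> y $$ (i, j))" if "i < n" "j < n" for i j
  proof -
    have "ip (translate (- y) (w i)) (w j) = ip (translate y (translate (- y) (w i))) (translate y (w j))"
      using that on by (intro ip_translate[symmetric] translate_L2) (auto simp: orthonormal_L2)
    also have "\<dots> = cnj (ip (translate y (w j)) (w i))"
      by (subst L2_inner_commute) (simp add: translate_translate)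
    finally show ?thesis
      using that by (simp add: matrix_coefficients_index)
  qed
  have at_y: "w i y = (\<Sum>j<n. cnj (?\<pi> y $$ (i, j)) * w j 0)" if "i < n" for i
  proof -
    have "w i y = translate (- y) (w i) 0"
      by (simp add: translate_def)
    then show ?thesis
      using that by (simp add: translate_basis[OF S w that] inv)
  qed
  have "reproducing_kernel n w (- y + x) = (\<Sum>j<n. cnj (w j 0) * translate y (w j) x)"
    by (simp add: reproducing_kernel_def translate_def)
  also have "\<dots> = (\<Sum>j<n. \<Sum>i<n. cnj (w j 0) * (?\<pi> y $$ (i, j) * w i x))"
    by (simp add: translate_basis[OF S w] sum_distrib_left)
  also have "\<dots> = (\<Sum>i<n. \<Sum>j<n. cnj (w j 0) * (?\<pi> y $$ (i, j) * w i x))"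
    by (rule sum.swap)
  also have "\<dots> = (\<Sum>i<n. cnj (w i y) * w i x)"
    by (intro sum.cong refl) (simp add: at_y sum_distrib_left sum_distrib_right mult_ac)
  finally show ?thesis .
qed

lemma reproducing_kernel_in:
  assumes "invariant_subspace S" "orthonormal_basis S n w"
  shows "reproducing_kernel n w \<in> S"
  unfolding reproducing_kernel_def[abs_def]
  using assms by (intro invariant_subspace_comb) (auto simp: orthonormal_basis_def)

lemma projection_eq_conv:
  assumes S: "invariant_subspace S" and w: "orthonormal_basis S n w" and u: "u \<in> L2"
  shows "projection \<mu> n w u = u \<star> reproducing_kernel n w"
proof
  fix x
  have on: "orthonormal \<mu> n w"
    using w by (simp add: orthonormal_basis_def)
  have "(u \<star> reproducing_kernel n w) x = (LINT y|\<mu>. (\<Sum>i<n. (u y * cnj (w i y)) * w i x))"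
    unfolding group_convolution_def reproducing_kernel_shift[OF S w] by (simp add: sum_distrib_left mult.assoc)
  also have "\<dots> = (\<Sum>i<n. LINT y|\<mu>. (u y * cnj (w i y)) * w i x)"
    using u on by (intro Bochner_Integration.integral_sum integrable_mult_left L2_inner_integrable)
      (auto simp: orthonormal_L2)
  also have "\<dots> = projection \<mu> n w u x"
    by (simp add: projection_def L2_inner_def)
  finally show "projection \<mu> n w u x = (u \<star> reproducing_kernel n w) x"
    by simp
qed

text \<open>
  The shifted kernel is constant on the diagonal, and its integral there is the trace of the projection.
\<close>

lemma reproducing_kernel_trace:
  assumes S: "invariant_subspace S" and w: "orthonormal_basis S n w"
  shows "reproducing_kernel n w 0 = of_nat n" and "(nrm (reproducing_kernel n w))\<^sup>2 = real n"
proof -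
  have on: "orthonormal \<mu> n w"
    using w by (simp add: orthonormal_basis_def)
  have "reproducing_kernel n w 0 = (LINT y|\<mu>. (\<Sum>i<n. w i y * cnj (w i y)))"
  proof -
    have "(\<Sum>i<n. w i y * cnj (w i y)) = reproducing_kernel n w 0" for y
      using reproducing_kernel_shift[OF S w, of y y] by (simp add: mult.commute)
    then show ?thesis by simp
  qed
  also have "\<dots> = (\<Sum>i<n. ip (w i) (w i))"
    unfolding L2_inner_def using on
    by (intro Bochner_Integration.integral_sum L2_inner_integrable) (auto simp: orthonormal_L2)
  also have "\<dots> = of_nat n"
    using on by (simp add: orthonormal_inner)
  finally show tr: "reproducing_kernel n w 0 = of_nat n" .
  have "(nrm (reproducing_kernel n w))\<^sup>2 = (\<Sum>j<n. (cmod (w j 0))\<^sup>2)"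
    unfolding reproducing_kernel_def[abs_def] orthonormal_comb_norm[OF on] by simp
  then have "complex_of_real ((nrm (reproducing_kernel n w))\<^sup>2) = reproducing_kernel n w 0"
    by (simp add: reproducing_kernel_def complex_norm_square mult.commute del: of_real_power)
  also have "\<dots> = of_real (real n)"
    using tr by simp
  finally show "(nrm (reproducing_kernel n w))\<^sup>2 = real n"
    by (simp only: of_real_eq_iff)
qed

text \<open>
  Let \<open>h = g \<star> invol g\<close>, let \<open>S\<close> be an irreducible subspace of an eigenspace of \<open>h\<close> with eigenvalue
  \<open>l > t\<close>, and let \<open>e\<close> be its reproducing kernel. The function \<open>g' = g - e \<star> g\<close> satisfies \<open>f \<star> g' = (f - f \<star> e) \<star> g\<close>,
  where \<open>f \<star> e\<close> is the projection of \<open>f\<close>. The two parts of \<open>f\<close> have orthogonal images under convolution by \<open>g\<close>, since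
  \<open>S\<close> consists of eigenfunctions of \<open>h\<close>. Moreover \<open>\<parallel>e \<star> g\<parallel>\<^sup>2 = l n\<close>, which is the amount by which \<open>\<parallel>g\<parallel>\<^sup>2\<close> drops.
\<close>

lemma peel_irreducible:
  assumes g: "g \<in> L2" and t: "0 < t" and f0: "f0 \<in> L2" and gap: "t * (nrm f0)\<^sup>2 < (nrm (f0 \<star> g))\<^sup>2"
  obtains l S n w g' where "t < l" "irreducible_subspace S" "n > 0" "orthonormal_basis S n w"
    "real n * l \<le> (nrm g)\<^sup>2" "g' \<in> L2" "(nrm g')\<^sup>2 \<le> (nrm g)\<^sup>2 - t"
    "\<And>f. f \<in> L2 \<Longrightarrow> (nrm (f \<star> g))\<^sup>2 = l * (nrm (projection \<mu> n w f))\<^sup>2 + (nrm (f \<star> g'))\<^sup>2"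
proof -
  define h where "h = g \<star> invol g"
  have h: "h \<in> L2"
    unfolding h_def by (intro conv_L2 g invol_L2)
  from eigenfunction_exists[OF g f0 _ gap] t obtain l v where l: "t < l"
    and v: "v \<in> L2" "nrm v \<noteq> 0" "v \<star> h = (\<lambda>x. of_real l * v x)"
    unfolding h_def by (metis less_imp_le)
  let ?V = "eigenspace h l"
  have l0: "l > 0"
    using t l by simp
  have "v \<in> ?V"
    using v by (simp add: eigenspace_def)
  then have V: "invariant_subspace ?V" "nontrivial ?V" "definite ?V"
    using v(2) l0 by (auto simp: nontrivial_def intro: invariant_subspace_eigenspace[OF h] definite_eigenspace[OF h])
  obtain m :: nat where m: "(nrm g)\<^sup>2 / l < real m"
    using reals_Archimedean2 by blast
  have "\<not> has_orthonormal ?V (Suc m)"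
  proof
    assume "has_orthonormal ?V (Suc m)"
    then have "real (Suc m) * l \<le> (nrm g)\<^sup>2"
      unfolding h_def by (rule eigenspace_dimension_bound[OF g])
    moreover have "(nrm g)\<^sup>2 < real m * l"
      using m l0 by (simp add: pos_divide_less_eq)
    ultimately show False
      using l0 by (simp add: distrib_right)
  qed
  from irreducible_subspace_exists[OF V this] obtain S n w where
    irr: "irreducible_subspace S" and SV: "S \<subseteq> ?V" and n: "n > 0" and w: "orthonormal_basis S n w"
    by blast
  have S: "invariant_subspace S"
    using irr by (simp add: irreducible_subspace_def)
  have on: "orthonormal \<mu> n w"
    using w by (simp add: orthonormal_basis_def)
  have dim: "real n * l \<le> (nrm g)\<^sup>2"
    using on w SV eigenspace_dimension_bound[OF g, of l n]
    by (auto simp: has_orthonormal_def orthonormal_basis_def h_def)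
  define e where "e = reproducing_kernel n w"
  have eS: "e \<in> S"
    unfolding e_def by (rule reproducing_kernel_in[OF S w])
  have e2: "e \<in> L2"
    by (rule invariant_subspace_L2[OF S eS])
  have eh: "e \<star> h = (\<lambda>x. of_real l * e x)"
    using eS SV by (auto simp: eigenspace_def)
  define p where "p = e \<star> g"
  have p2: "p \<in> L2"
    unfolding p_def by (intro conv_L2 e2 g)
  define g' where "g' = (\<lambda>x. g x - p x)"
  have g'2: "g' \<in> L2"
    unfolding g'_def by (intro L2_diff g p2)
  have "ip p g = of_real (l * real n)"
  proof -
    have "ip p g = ip e h"
      unfolding p_def h_def by (rule conv_adjoint[OF e2 g g])
    also have "\<dots> = (e \<star> h) 0"
      unfolding conv_0 h_def by (simp add: conv_invol g invol_L2)
    also have "\<dots> = of_real (l * real n)"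
      unfolding eh unfolding e_def reproducing_kernel_trace(1)[OF S w] by simp
    finally show ?thesis .
  qed
  moreover have pp: "(nrm p)\<^sup>2 = l * real n"
    using eigenspace_conv_norm[OF g, of e l] eS SV reproducing_kernel_trace(2)[OF S w]
    by (auto simp: p_def h_def e_def)
  ultimately have "ip p g' = 0"
    unfolding g'_def L2_inner_diff_right[OF g p2 p2] L2_inner_self by simp
  then have "ip g' p = 0"
    by (subst L2_inner_commute) simp
  from L2_norm_pythagoras[OF g'2 p2 this] have "(nrm g)\<^sup>2 = (nrm g')\<^sup>2 + l * real n"
    by (simp add: g'_def pp)
  moreover have "t \<le> l * real n"
  proof -
    have "l * 1 \<le> l * real n"
      using l0 n by (intro mult_left_mono) auto
    then show ?thesis
      using l by simp
  qed
  ultimately have g'_norm: "(nrm g')\<^sup>2 \<le> (nrm g)\<^sup>2 - t"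
    by simp
  have split: "(nrm (f \<star> g))\<^sup>2 = l * (nrm (projection \<mu> n w f))\<^sup>2 + (nrm (f \<star> g'))\<^sup>2" if f: "f \<in> L2" for f
  proof -
    define u where "u = projection \<mu> n w f"
    have u_conv: "u = f \<star> e"
      unfolding u_def e_def by (rule projection_eq_conv[OF S w f])
    have uS: "u \<in> S"
      unfolding u_def using w by (intro invariant_subspace_projection[OF S]) (simp add: orthonormal_basis_def)
    have u2: "u \<in> L2"
      by (rule invariant_subspace_L2[OF S uS])
    define r where "r = (\<lambda>x. f x - u x)"
    have r2: "r \<in> L2"
      unfolding r_def by (intro L2_diff f u2)
    have fg': "f \<star> g' = r \<star> g"
      unfolding g'_def r_def conv_diff_right[OF f g p2] conv_diff_left[OF f u2 g]
      by (simp add: p_def u_conv conv_assoc f e2 g)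
    have fg: "f \<star> g = (\<lambda>x. (u \<star> g) x + (r \<star> g) x)"
      unfolding conv_add_left[OF u2 r2 g, symmetric] by (simp add: r_def)
    have "ip (u \<star> g) (r \<star> g) = ip (u \<star> h) r"
      unfolding h_def by (rule conv_square_inner[OF g u2 r2, symmetric])
    also have "u \<star> h = (\<lambda>x. of_real l * u x)"
      using uS SV by (auto simp: eigenspace_def)
    also have "ip (\<lambda>x. of_real l * u x) r = 0"
      unfolding L2_inner_scale_left r_def u_def
      using projection_residue_orthogonal(2)[OF on f, of f] by simp
    finally have "(nrm (f \<star> g))\<^sup>2 = (nrm (u \<star> g))\<^sup>2 + (nrm (r \<star> g))\<^sup>2"
      unfolding fg by (intro L2_norm_pythagoras conv_L2 u2 r2 g)
    also have "(nrm (u \<star> g))\<^sup>2 = l * (nrm u)\<^sup>2"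
      using uS SV by (intro eigenspace_conv_norm[OF g]) (auto simp: h_def)
    finally show ?thesis
      by (simp add: fg' u_def)
  qed
  show ?thesis
    by (rule that[OF l irr n w dim g'2 g'_norm split])
qed

text \<open>
  Induction on a bound \<open>N\<close> for \<open>\<parallel>g\<parallel>\<^sup>2 / t\<close>. If no \<open>f\<close> is amplified by more than \<open>t\<close>, the error term suffices;
  otherwise an irreducible space is split off. Its projection is a convolution from the right and so commutes with
  convolution by \<open>P\<close> from the left. The bound \<open>G\<close> on \<open>\<parallel>g\<parallel>\<^sup>2\<close> stays fixed, so all the spaces that
  occur satisfy the same dimension bound \<open>n \<le> G / t\<close>.
\<close>

lemma conv_norm_split:
  assumes P: "P \<in> L2" and central: "\<And>u. u \<in> L2 \<Longrightarrow> u \<star> P = P \<star> u" and t: "0 < t"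
    and low: "\<And>S n w u. \<lbrakk>irreducible_subspace S; orthonormal_basis S n w; n > 0; real n * t \<le> G; u \<in> S\<rbrakk>
      \<Longrightarrow> nrm u \<le> b * nrm (P \<star> u)"
    and b: "1 \<le> b"
    and g: "g \<in> L2" "(nrm g)\<^sup>2 \<le> G" "(nrm g)\<^sup>2 \<le> real N * t" and f: "f \<in> L2"
  shows "(nrm (f \<star> g))\<^sup>2 \<le> b ^ 4 * (nrm ((f \<star> P \<star> P) \<star> g))\<^sup>2 + t * (nrm f)\<^sup>2"
  using g f
proof (induction N arbitrary: g f)
  case 0
  then have "nrm g = 0"
    by simp
  then have "nrm (f \<star> g) \<le> 0"
    using nrm_conv_le[OF 0(4,1)] by simp
  then have "(nrm (f \<star> g))\<^sup>2 = 0"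
    by (simp add: antisym)
  then show ?case
    using t by simp
next
  case (Suc N)
  note g = \<open>g \<in> L2\<close> and f = \<open>f \<in> L2\<close>
  show ?case
  proof (cases "\<exists>f0\<in>L2. t * (nrm f0)\<^sup>2 < (nrm (f0 \<star> g))\<^sup>2")
    case False
    then have "(nrm (f \<star> g))\<^sup>2 \<le> t * (nrm f)\<^sup>2"
      using f by (auto simp: not_less)
    also have "\<dots> \<le> b ^ 4 * (nrm ((f \<star> P \<star> P) \<star> g))\<^sup>2 + t * (nrm f)\<^sup>2"
      by simp
    finally show ?thesis .
  next
    case True
    then obtain f0 where f0: "f0 \<in> L2" "t * (nrm f0)\<^sup>2 < (nrm (f0 \<star> g))\<^sup>2"
      by blast
    obtain l S n w g' where l: "t < l" and irr: "irreducible_subspace S" and n: "n > 0"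
      and w: "orthonormal_basis S n w" and dim: "real n * l \<le> (nrm g)\<^sup>2"
      and g': "g' \<in> L2" "(nrm g')\<^sup>2 \<le> (nrm g)\<^sup>2 - t"
      and split: "\<And>f. f \<in> L2 \<Longrightarrow>
        (nrm (f \<star> g))\<^sup>2 = l * (nrm (projection \<mu> n w f))\<^sup>2 + (nrm (f \<star> g'))\<^sup>2"
      by (rule peel_irreducible[OF g t f0]) blast
    have S: "invariant_subspace S"
      using irr by (simp add: irreducible_subspace_def)
    define e where "e = reproducing_kernel n w"
    have e: "e \<in> L2"
      unfolding e_def by (rule invariant_subspace_L2[OF S reproducing_kernel_in[OF S w]])
    have proj: "projection \<mu> n w u = u \<star> e" if "u \<in> L2" for u
      unfolding e_def by (rule projection_eq_conv[OF S w that])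
    have proj_S: "projection \<mu> n w u \<in> S" for u
      using w by (intro invariant_subspace_projection[OF S]) (simp add: orthonormal_basis_def)
    have "real n * t \<le> real n * l"
      using l by (intro mult_left_mono) auto
    then have nt: "real n * t \<le> G"
      using dim Suc.prems(2) by linarith
    have step: "nrm (projection \<mu> n w u) \<le> b * nrm (projection \<mu> n w (P \<star> u))" if u: "u \<in> L2" for u
    proof -
      have "nrm (projection \<mu> n w u) \<le> b * nrm (P \<star> projection \<mu> n w u)"
        by (rule low[OF irr w n nt proj_S])
      also have "P \<star> projection \<mu> n w u = projection \<mu> n w (P \<star> u)"
        using u by (simp add: proj conv_L2 P conv_assoc e)
      finally show ?thesis .
    qed
    define q where "q = f \<star> P \<star> P"
    have q: "q \<in> L2"
      unfolding q_def by (intro conv_L2 f P)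
    have q_eq: "q = P \<star> (P \<star> f)"
      unfolding q_def by (simp add: central conv_L2 f P)
    have "nrm (projection \<mu> n w f) \<le> b * nrm (projection \<mu> n w (P \<star> f))"
      by (rule step[OF f])
    also have "\<dots> \<le> b * (b * nrm (projection \<mu> n w q))"
      unfolding q_eq using b by (intro mult_left_mono step conv_L2 P f) auto
    finally have "(nrm (projection \<mu> n w f))\<^sup>2 \<le> (b * (b * nrm (projection \<mu> n w q)))\<^sup>2"
      by (intro power_mono) auto
    also have "\<dots> = b ^ 4 * (nrm (projection \<mu> n w q))\<^sup>2"
      by (simp add: power_mult_distrib power_add[symmetric] mult.assoc[symmetric])
    finally have main: "l * (nrm (projection \<mu> n w f))\<^sup>2 \<le> l * (b ^ 4 * (nrm (projection \<mu> n w q))\<^sup>2)"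
      using l t by (intro mult_left_mono) auto
    have "(nrm (f \<star> g'))\<^sup>2 \<le> b ^ 4 * (nrm (q \<star> g'))\<^sup>2 + t * (nrm f)\<^sup>2"
      unfolding q_def using g' Suc.prems(2,3) t f by (intro Suc.IH) (auto simp: distrib_right)
    then have "(nrm (f \<star> g))\<^sup>2 \<le> b ^ 4 * (l * (nrm (projection \<mu> n w q))\<^sup>2 + (nrm (q \<star> g'))\<^sup>2) + t * (nrm f)\<^sup>2"
      unfolding split[OF f] using main by (simp add: algebra_simps)
    then show ?thesis
      unfolding split[OF q, symmetric] by (simp add: q_def)
  qed
qed

section \<open>Averaging over small balls\<close>

lemma
  assumes m: "measure \<mu> (ball 0 \<eta>) > 0"
  shows ball_kernel_L2: "ball_kernel \<mu> \<eta> \<in> L2"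
    and ball_kernel_norm_integral: "(LINT x|\<mu>. cmod (ball_kernel \<mu> \<eta> x)) = 1"
    and ball_kernel_integral: "(LINT x|\<mu>. ball_kernel \<mu> \<eta> x) = 1"
proof -
  let ?m = "measure \<mu> (ball 0 \<eta>)"
  have P: "ball_kernel \<mu> \<eta> = (\<lambda>x. complex_of_real (indicator (ball 0 \<eta>) x / ?m))"
    by (auto simp: ball_kernel_def fun_eq_iff indicator_def)
  have [measurable]: "ball (0 :: 'a) \<eta> \<in> sets borel"
    by simp
  show "ball_kernel \<mu> \<eta> \<in> L2"
    unfolding P using m by (intro L2_of_bounded[of _ _ "1 / ?m"])
      (auto intro: finite_measure_axioms simp: indicator_def norm_divide)
  have 1: "(LINT x|\<mu>. indicator (ball 0 \<eta>) x / ?m) = 1"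
    using m by simp
  show "(LINT x|\<mu>. ball_kernel \<mu> \<eta> x) = 1"
    unfolding P integral_complex_of_real 1 by simp
  have "cmod (ball_kernel \<mu> \<eta> x) = indicator (ball 0 \<eta>) x / ?m" for x
    unfolding P norm_of_real by (simp add: indicator_def)
  then show "(LINT x|\<mu>. cmod (ball_kernel \<mu> \<eta> x)) = 1"
    using 1 by simp
qed

text \<open>
  Bi-invariance of the metric makes the ball invariant under conjugation, so that \<open>x - y\<close> and \<open>- y + x\<close> belong to
  it simultaneously.
\<close>

lemma ball_kernel_central: "u \<star> ball_kernel \<mu> \<eta> = ball_kernel \<mu> \<eta> \<star> u" if u: "u \<in> L2"
proof
  fix x :: 'a
  let ?P = "ball_kernel \<mu> \<eta>"
  have [measurable]: "u \<in> borel_measurable borel"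
    using u by (rule L2_borel)
  have [measurable]: "ball (0 :: 'a) \<eta> \<in> sets borel"
    by simp
  have [measurable]: "?P \<in> borel_measurable borel"
    unfolding ball_kernel_def[abs_def] by measurable
  have "dist 0 (x + - y) = dist 0 (- y + x)" for y :: 'a
    using dist_right[of 0 y "x + - y"] dist_left[of y 0 "- y + x"]
    by (simp add: add.assoc del: add_uminus_conv_diff)
  then have P: "?P (x + - y) = ?P (- y + x)" for y :: 'a
    by (simp add: ball_kernel_def indicator_def del: add_uminus_conv_diff)
  have "(?P \<star> u) x = (LINT y|\<mu>. ?P (- y) * u (y + x))"
    unfolding group_convolution_def using integral_uminus[of "\<lambda>y. ?P y * u (- y + x)"] by simp
  also have "\<dots> = (LINT y|\<mu>. ?P (- (y + - x)) * u ((y + - x) + x))"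
    by (rule integral_right[symmetric]) measurable
  also have "\<dots> = (u \<star> ?P) x"
    unfolding group_convolution_def
    by (simp add: minus_add add.assoc P mult.commute del: add_uminus_conv_diff)
  finally show "(u \<star> ?P) x = (?P \<star> u) x"
    by simp
qed

text \<open>
  Convolution by the kernel from the left is the mean of the translates \<open>translate a u\<close> over the ball. The claim is tested
  against the difference \<open>z\<close> itself, which replaces an integral of functions by one of numbers.
\<close>

lemma ball_kernel_close:
  assumes m: "measure \<mu> (ball 0 \<eta>) > 0" and u: "u \<in> L2" and B: "0 \<le> B"
    and close: "\<And>a. a \<in> ball 0 \<eta> \<Longrightarrow> nrm (\<lambda>x. translate a u x - u x) \<le> B"
  shows "nrm (\<lambda>x. (ball_kernel \<mu> \<eta> \<star> u) x - u x) \<le> B"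
proof -
  let ?P = "ball_kernel \<mu> \<eta>"
  have P: "?P \<in> L2"
    by (rule ball_kernel_L2[OF m])
  define z where "z = (\<lambda>x. (?P \<star> u) x - u x)"
  have Pu: "?P \<star> u \<in> L2"
    by (intro conv_L2 P u)
  have z: "z \<in> L2"
    unfolding z_def by (intro L2_diff Pu u)
  have tr: "ip (translate a u) z = cnj ((z \<star> invol u) a)" for a
    by (subst L2_inner_commute) (simp add: ip_translate_eq_conv)
  have Pint: "integrable \<mu> ?P"
    by (rule L2_integrable[OF finite_measure_axioms P])
  have int: "integrable \<mu> (\<lambda>a. ?P a * cnj ((z \<star> invol u) a))"
    by (intro L2_inner_integrable P conv_L2 z invol_L2 u)
  have "ip z z = ip (?P \<star> u) z - ip u z"
    by (subst z_def) (rule L2_inner_diff_left[OF Pu u z])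
  also have "ip (?P \<star> u) z = (LINT a|\<mu>. ?P a * ip (translate a u) z)"
    unfolding conv_adjoint[OF P u z] tr by (simp add: L2_inner_def)
  also have "ip u z = (LINT a|\<mu>. ?P a * ip u z)"
    using ball_kernel_integral[OF m] by simp
  also have "(LINT a|\<mu>. ?P a * ip (translate a u) z) - (LINT a|\<mu>. ?P a * ip u z)
      = (LINT a|\<mu>. ?P a * ip (translate a u) z - ?P a * ip u z)"
    using int Pint unfolding tr by (intro Bochner_Integration.integral_diff[symmetric] integrable_mult_left)
  also have "\<dots> = (LINT a|\<mu>. ?P a * ip (\<lambda>x. translate a u x - u x) z)"
    by (simp add: L2_inner_diff_left translate_L2 u z right_diff_distrib)
  finally have zz: "complex_of_real ((nrm z)\<^sup>2) = (LINT a|\<mu>. ?P a * ip (\<lambda>x. translate a u x - u x) z)"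
    unfolding L2_inner_self .
  have "(nrm z)\<^sup>2 = cmod (complex_of_real ((nrm z)\<^sup>2))"
    unfolding norm_of_real by simp
  also have "\<dots> \<le> (LINT a|\<mu>. cmod (?P a * ip (\<lambda>x. translate a u x - u x) z))"
    unfolding zz by (rule integral_norm_bound)
  also have "\<dots> \<le> (LINT a|\<mu>. cmod (?P a) * (B * nrm z))"
  proof (rule integral_mono)
    have "integrable \<mu> (\<lambda>a. ?P a * cnj ((z \<star> invol u) a) - ?P a * ip u z)"
      using int Pint by (intro Bochner_Integration.integrable_diff integrable_mult_left)
    then show "integrable \<mu> (\<lambda>a. cmod (?P a * ip (\<lambda>x. translate a u x - u x) z))"
      by (intro integrable_norm) (simp add: L2_inner_diff_left translate_L2 u z tr right_diff_distrib)
    show "integrable \<mu> (\<lambda>a. cmod (?P a) * (B * nrm z))"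
      using Pint by (intro integrable_mult_left integrable_norm)
    fix a
    show "cmod (?P a * ip (\<lambda>x. translate a u x - u x) z) \<le> cmod (?P a) * (B * nrm z)"
    proof (cases "a \<in> ball 0 \<eta>")
      case True
      have "cmod (ip (\<lambda>x. translate a u x - u x) z) \<le> nrm (\<lambda>x. translate a u x - u x) * nrm z"
        by (intro L2_inner_le L2_diff translate_L2 u z)
      also have "\<dots> \<le> B * nrm z"
        using close[OF True] by (intro mult_right_mono) auto
      finally show ?thesis
        unfolding norm_mult by (intro mult_left_mono) auto
    next
      case False
      then show ?thesis
        by (simp add: ball_kernel_def)
    qed
  qed
  also have "\<dots> = B * nrm z"
    using ball_kernel_norm_integral[OF m] by simp
  finally have "nrm z * nrm z \<le> B * nrm z"
    by (simp add: power2_eq_square)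
  then have "nrm z \<le> B"
    using B by (cases "nrm z = 0") (auto simp: less_le mult_le_cancel_right)
  then show ?thesis
    by (simp add: z_def)
qed

text \<open>
  The dimension bound is the one for which \<open>n powr L * sqrt \<eta> \<le> 1\<close>, so that the displacement
  \<open>C * n powr L * \<eta>\<close> is at most \<open>C * sqrt \<eta> \<le> 0.1\<close>. Hence \<open>\<parallel>u\<parallel> \<le> \<parallel>P \<star> u\<parallel> + \<parallel>u\<parallel> / 10\<close>.
\<close>

lemma low_dimensional_smoothing:
  assumes m: "measure \<mu> (ball 0 \<eta>) > 0" and \<eta>: "\<eta> > 0" and C: "C \<ge> 1" and L: "L \<ge> 1"
    and lr: "locally_random TYPE('a) L C" and small: "C * sqrt \<eta> \<le> 0.1"
    and irr: "irreducible_subspace S" and w: "orthonormal_basis S n w" and n: "n > 0"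
    and dim: "real n * \<eta> powr (1 / (2 * L)) \<le> 1" and u: "u \<in> S"
  shows "nrm u \<le> 10 / 9 * nrm (ball_kernel \<mu> \<eta> \<star> u)"
proof -
  let ?P = "ball_kernel \<mu> \<eta>"
  have S: "invariant_subspace S"
    using irr by (simp add: irreducible_subspace_def)
  have u2: "u \<in> L2"
    by (rule invariant_subspace_L2[OF S u])
  have Pu: "?P \<star> u \<in> L2"
    by (intro conv_L2 ball_kernel_L2 m u2)
  have "real n * \<eta> powr (1 / (2 * L)) = (real n powr L * sqrt \<eta>) powr (1 / L)"
    using \<eta> L n by (simp add: powr_mult powr_powr powr_half_sqrt[symmetric])
  then have "(real n powr L * sqrt \<eta>) powr (1 / L) \<le> 1 powr (1 / L)"
    using dim by simp
  then have nL: "real n powr L * sqrt \<eta> \<le> 1"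
    using L \<eta> powr_less_mono2[of "1 / L" 1 "real n powr L * sqrt \<eta>"] by (auto simp: not_less[symmetric])
  have rate: "C * real n powr L * dist a 0 \<le> 0.1" if "a \<in> ball (0::'a) \<eta>" for a
  proof -
    have "C * real n powr L * dist a 0 \<le> C * real n powr L * (sqrt \<eta> * sqrt \<eta>)"
      using that C \<eta> by (intro mult_left_mono) (auto simp: dist_commute less_imp_le)
    also have "\<dots> = (real n powr L * sqrt \<eta>) * (C * sqrt \<eta>)"
      by simp
    also have "\<dots> \<le> 1 * (C * sqrt \<eta>)"
      using nL C \<eta> by (intro mult_right_mono) auto
    finally show ?thesis
      using small by simp
  qed
  have "nrm (\<lambda>x. (?P \<star> u) x - u x) \<le> 0.1 * nrm u"
  proof (rule ball_kernel_close[OF m u2])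
    fix a :: 'a assume a: "a \<in> ball 0 \<eta>"
    have "nrm (\<lambda>x. translate a u x - u x) \<le> C * real n powr L * dist a 0 * nrm u"
      by (rule translate_close_on_irreducible[OF lr irr w n u])
    also have "\<dots> \<le> 0.1 * nrm u"
      using rate[OF a] by (intro mult_right_mono) auto
    finally show "nrm (\<lambda>x. translate a u x - u x) \<le> 0.1 * nrm u" .
  qed simp
  moreover have "nrm u \<le> nrm (?P \<star> u) + nrm (\<lambda>x. (?P \<star> u) x - u x)"
  proof -
    have "nrm (\<lambda>x. - 1 * ((?P \<star> u) x - u x)) = nrm (\<lambda>x. (?P \<star> u) x - u x)"
      by (subst L2_norm_scale) simp
    then show ?thesis
      using L2_norm_triangle[OF Pu L2_scale[OF L2_diff[OF Pu u2], of "- 1"]] by simp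
  qed
  ultimately show ?thesis
    by simp
qed

end

section \<open>Convolution before and after smoothing\<close>

theorem theorem2p6:
  fixes \<mu> :: "'a::{metric_space, second_countable_topology, topological_group_add} measure"
    and f g :: "'a \<Rightarrow> complex"
    and L C\<^sub>0 C\<^sub>1 d\<^sub>0 \<eta> :: real
  assumes "compact (UNIV :: 'a set)"
    and "bi_invariant_dist TYPE('a)"
    and "haar_probability \<mu>"
    and "C\<^sub>0 \<ge> 1" and "L \<ge> 1" and "locally_random TYPE('a) L C\<^sub>0"
    and "C\<^sub>1 \<ge> 1" and "d\<^sub>0 > 0" and "dimension_condition \<mu> C\<^sub>1 d\<^sub>0"
    and "f \<in> L2_space \<mu>" and "g \<in> L2_space \<mu>"
    and "\<eta> > 0" and "C\<^sub>0 * sqrt \<eta> \<le> 0.1"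
  shows "(L2_norm \<mu> (group_convolution \<mu> f g))\<^sup>2
    \<le> 2 * (L2_norm \<mu> (group_convolution \<mu> (smoothing \<mu> \<eta> f) (smoothing \<mu> \<eta> g)))\<^sup>2
      + \<eta> powr (1 / (2 * L)) * (L2_norm \<mu> f)\<^sup>2 * (L2_norm \<mu> g)\<^sup>2"
proof -
  interpret compact_metric_group \<mu>
    by standard (use assms in auto)
  note f = \<open>f \<in> L2_space \<mu>\<close> and g = \<open>g \<in> L2_space \<mu>\<close>
  let ?P = "ball_kernel \<mu> \<eta>"
  have "1 * sqrt \<eta> \<le> C\<^sub>0 * sqrt \<eta>"
    using assms by (intro mult_right_mono) auto
  then have "sqrt \<eta> < 1"
    using \<open>C\<^sub>0 * sqrt \<eta> \<le> 0.1\<close> by linarith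
  \<comment> \<open>\<open>C\<^sub>0 \<ge> 1\<close> forces \<open>sqrt \<eta> \<le> 0.1\<close>\<close>
  then have \<eta>1: "\<eta> \<in> {0<..<1}"
    using assms by simp
  \<comment> \<open>the lower bound of the dimension condition, at a radius below 1\<close>
  have m: "measure \<mu> (ball 0 \<eta>) > 0"
  proof -
    have "0 < 1 / C\<^sub>1 * \<eta> powr d\<^sub>0"
      using assms by simp
    also have "\<dots> \<le> measure \<mu> (ball 0 \<eta>)"
      using assms(9) \<eta>1 by (simp add: dimension_condition_def)
    finally show ?thesis .
  qed
  note P = ball_kernel_L2[OF m]
  define \<delta> where "\<delta> = \<eta> powr (1 / (2 * L))"
  have \<delta>: "\<delta> > 0"
    using assms by (simp add: \<delta>_def)
  show ?thesis
  proof (cases "nrm g = 0")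
    case True
    then have "nrm (f \<star> g) \<le> 0"
      using nrm_conv_le[OF f g] by simp
    then have "(nrm (f \<star> g))\<^sup>2 = 0"
      by (simp add: antisym)
    then show ?thesis
      by simp
  next
    case False
    define G where "G = (nrm g)\<^sup>2"
    have G: "G > 0"
      using False by (simp add: G_def)
    obtain N :: nat where N: "1 / \<delta> < real N"
      using reals_Archimedean2 by blast
    have "(nrm (f \<star> g))\<^sup>2 \<le> (10 / 9) ^ 4 * (nrm ((f \<star> ?P \<star> ?P) \<star> g))\<^sup>2 + \<delta> * G * (nrm f)\<^sup>2"
    proof (rule conv_norm_split[OF P, where G = G and N = N])
      show "u \<star> ?P = ?P \<star> u" if "u \<in> L2" for u
        using that by (rule ball_kernel_central)
      show "0 < \<delta> * G"
        using \<delta> G by simp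
      show "(nrm g)\<^sup>2 \<le> real N * (\<delta> * G)"
        using N \<delta> G by (simp add: G_def[symmetric] field_simps)
      fix S n w u
      assume "irreducible_subspace S" "orthonormal_basis S n w" "n > 0" "u \<in> S" "real n * (\<delta> * G) \<le> G"
      moreover from this G have "real n * \<delta> \<le> 1"
        by (simp add: mult.assoc[symmetric])
      ultimately show "nrm u \<le> 10 / 9 * nrm (?P \<star> u)"
        using assms by (intro low_dimensional_smoothing[OF m]) (auto simp: \<delta>_def)
    qed (simp_all add: f g G_def)
    also have "(f \<star> ?P \<star> ?P) \<star> g = (f \<star> ?P) \<star> (g \<star> ?P)"
      using conv_assoc[OF conv_L2[OF f P] P g] ball_kernel_central[OF g] by simp
    also have "(10 / 9) ^ 4 * (nrm ((f \<star> ?P) \<star> (g \<star> ?P)))\<^sup>2 \<le> 2 * (nrm ((f \<star> ?P) \<star> (g \<star> ?P)))\<^sup>2"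
      by (intro mult_right_mono) (simp_all add: power_divide)
    finally show ?thesis
      by (simp add: smoothing_def \<delta>_def G_def mult_ac)
  qed
qed

end
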